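(* Every oriented tree with $n\ge 3$ vertices and $k$ leaves is $\left(\frac92 n-\frac52 k-\frac92\right)$-unavoidable.
   Context: A tournament is an orientation of a complete graph. A digraph $D$ is $m$-unavoidable if every tournament of order $\lceil m\rceil$ contains $D$ as a subdigraph. An oriented tree is an orientation of a tree. A leaf of an oriented tree is a vertex adjacent to at most one vertex. *)

theory Defs
  imports Complex_Main "Graph_Theory.Graph_Theory"
begin

text \<open>
  Undirected graphs are symmetric loop-free digraphs, as in the AFP entry on graph theory
  (\<^locale>\<open>pair_graph\<close>); a digraph without parallel arcs is a \<^typ>\<open>'a pair_pre_digraph\<close>.
\<close>

definition orientation :: "'a pair_pre_digraph \<Rightarrow> 'a pair_pre_digraph \<Rightarrow> bool" where
  "orientation D G \<longleftrightarrow>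
     pverts D = pverts G \<and>
     parcs D \<union> (parcs D)\<inverse> = parcs G \<and>
     parcs D \<inter> (parcs D)\<inverse> = {}"

definition tournament :: "'a pair_pre_digraph \<Rightarrow> bool" where
  "tournament T \<longleftrightarrow> (\<exists>n G. complete_digraph n (with_proj G) \<and> orientation T G)"

text \<open>
  The library's \<^const>\<open>tree\<close> is not usable here: its notion of cycle is directed and includes
  the closed walk $a, b, a$, so no symmetric digraph with an edge is a \<^const>\<open>tree\<close>, while the
  transitive tournament on three vertices is one. A cycle of an undirected graph is a
  cycle of length at least 3 of the symmetric digraph.
\<close>

definition undirected_tree :: "'a pair_pre_digraph \<Rightarrow> bool" where
  "undirected_tree G \<longleftrightarrow>
     pair_graph G \<and> Digraph_Component.connected (with_proj G) \<and>
     \<not> (\<exists>p. pre_digraph.cycle (with_proj G) p \<and> 3 \<le> length p)"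

definition oriented_tree :: "'a pair_pre_digraph \<Rightarrow> bool" where
  "oriented_tree D \<longleftrightarrow> (\<exists>G. undirected_tree G \<and> orientation D G)"

definition leaves :: "'a pair_pre_digraph \<Rightarrow> 'a set" where
  "leaves D = {v \<in> pverts D. card {u \<in> pverts D. (u, v) \<in> parcs D \<or> (v, u) \<in> parcs D} \<le> 1}"

definition contains_subdigraph :: "'b pair_pre_digraph \<Rightarrow> 'a pair_pre_digraph \<Rightarrow> bool" where
  "contains_subdigraph T D \<longleftrightarrow>
     (\<exists>H :: 'b pair_pre_digraph.
        subgraph (with_proj H) (with_proj T) \<and> digraph_iso (with_proj D) (with_proj H))"

text \<open>
  HOL cannot quantify over types inside a formula, so the type \<^typ>\<open>'b\<close> of the vertices of the
  tournaments is a parameter; leaving it as a type variable in a theorem quantifies over all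
  tournaments.
\<close>

definition unavoidable :: "'b itself \<Rightarrow> real \<Rightarrow> 'a pair_pre_digraph \<Rightarrow> bool" where
  "unavoidable (_ :: 'b itself) m D \<longleftrightarrow>
     (\<forall>T :: 'b pair_pre_digraph.
        tournament T \<and> int (card (pverts T)) = \<lceil>m\<rceil> \<longrightarrow> contains_subdigraph T D)"

end

(*
  A median order of a tournament is an ordering of its vertices with the maximum number of
  forward arcs. In it, each vertex dominates at least half of every interval that starts right
  after it and is dominated by at least half of every interval that ends right before it.

  Let the tree have d + 1 nodes that are not leaves, and root the tree of these nodes at a
  neighbour of a leaf; let c be the number of its childless nodes. An arborescence with m nodes,
  b of them childless, embeds greedily in a median order of m + b - 1 vertices. Cutting the inner
  tree into such arborescences, and averaging the resulting bound with the one for the reversed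
  tree, shows that every tournament of order 2d + c contains the inner tree.

  In a median order of 4d + 2k + 1 vertices, embed the inner tree in a middle block of 2d + c
  consecutive vertices. The in-leaves are then found mainly to the left of the block and the
  out-leaves mainly to the right, by Hall's theorem: the root and every childless node carry a
  leaf, which makes up for the summand c. Finally 4d + 2k + 1 is at most the bound if d > 0, and
  2k vertices suffice if d = 0.
*)

theory Submission
  imports Defs
begin

section \<open>Median orders\<close>

text \<open>With \<open>n = d + 1 + k\<close> the bound of the theorem reads
  \<open>9d/2 + 2k\<close>. The greedy scan serves arcs of one direction only, so the inner tree is
  cut at the arcs of the other direction. A piece hangs on a node that is already placed and must
  avoid the vertices in use. A median order promises only half of the vertices that follow, so two
  vertices are reserved for each one that the piece requires, and a piece with m nodes, b of them
  childless, costs 2(m + b - 1). The total depends on the directions of the arcs, but the totals for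
  the tree and for its reversal add up to at most an amount determined by d and c alone. The leaves
  come last: their neighbours are placed, so they only need distinct free vertices, a matching
  problem for which it does not matter how the inner tree lies inside its block. The obstacle is
  that in-leaves and out-leaves may compete for the same vertices; it is this competition, and not
  the two separate demands, that asks for 4d + 2k + 1 vertices.\<close>

definition tournament_on :: "('v \<Rightarrow> 'v \<Rightarrow> bool) \<Rightarrow> 'v set \<Rightarrow> bool" where
  "tournament_on Q V \<longleftrightarrow> (\<forall>x\<in>V. \<forall>y\<in>V. x \<noteq> y \<longrightarrow> (Q x y \<longleftrightarrow> \<not> Q y x))"

text \<open>Encoded by the two interval consequences of maximality, which pass to every prefix at
  once. Counts are doubled to avoid halves of odd lengths. In the first condition \<open>j\<close>
  is an exclusive end, so \<open>j = N\<close> is allowed; in the second it is a vertex.\<close>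

definition median_order :: "(nat \<Rightarrow> nat \<Rightarrow> bool) \<Rightarrow> nat \<Rightarrow> bool" where
  "median_order Q N \<longleftrightarrow> tournament_on Q {..<N} \<and>
     (\<forall>i j. i < j \<and> j \<le> N \<longrightarrow> j - Suc i \<le> 2 * card {t \<in> {i<..<j}. Q i t}) \<and>
     (\<forall>i j. i \<le> j \<and> j < N \<longrightarrow> j - i \<le> 2 * card {t \<in> {i..<j}. Q t j})"

fun forward_arcs :: "('v \<Rightarrow> 'v \<Rightarrow> bool) \<Rightarrow> 'v list \<Rightarrow> nat" where
  "forward_arcs Q [] = 0"
| "forward_arcs Q (x # xs) = length (filter (Q x) xs) + forward_arcs Q xs"

lemma forward_arcs_append:
  "forward_arcs Q (xs @ ys) =
     forward_arcs Q xs + forward_arcs Q ys + (\<Sum>x\<leftarrow>xs. length (filter (Q x) ys))"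
  by (induction xs) auto

lemma sum_list_filter_Cons:
  "(\<Sum>x\<leftarrow>vs. length (filter (Q x) (y # ws))) =
     length (filter (\<lambda>x. Q x y) vs) + (\<Sum>x\<leftarrow>vs. length (filter (Q x) ws))"
  by (induction vs) auto

text \<open>Moving \<open>x\<close> across \<open>vs\<close> affects only the pairs formed by
  \<open>x\<close> and a member of \<open>vs\<close>. Written additively to avoid subtraction of
  naturals; read in either direction it yields one half of the median property.\<close>

lemma forward_arcs_move:
  "forward_arcs Q (us @ x # vs @ ws) + length (filter (\<lambda>v. Q v x) vs) =
   forward_arcs Q (us @ vs @ x # ws) + length (filter (Q x) vs)"
proof -
  have "(\<Sum>u\<leftarrow>us. length (filter (Q u) (x # vs @ ws))) =
        (\<Sum>u\<leftarrow>us. length (filter (Q u) (vs @ x # ws)))"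
    by (rule arg_cong[where f = sum_list], rule map_cong) auto
  then show ?thesis
    by (simp add: forward_arcs_append sum_list_filter_Cons del: filter_append filter.simps)
      (simp add: forward_arcs_append sum_list_filter_Cons)
qed

lemma forward_arcs_le: "forward_arcs Q xs \<le> length xs * length xs"
proof (induction xs)
  case (Cons x xs)
  show ?case unfolding forward_arcs.simps length_Cons mult_Suc mult_Suc_right
    using Cons length_filter_le[of "Q x" xs] by linarith
qed simp

lemma length_filter_segment:
  assumes "a \<le> b" "b \<le> length xs"
  shows "length (filter P (drop a (take b xs))) = card {t \<in> {a..<b}. P (xs ! t)}"
proof -
  have "length (filter P (drop a (take b xs))) = card {k. k < b - a \<and> P (xs ! (a + k))}"
    using assms by (auto simp: length_filter_conv_card intro!: arg_cong[where f = card])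
  also have "\<dots> = card ((+) a ` {k. k < b - a \<and> P (xs ! (a + k))})"
    by (simp add: card_image)
  also have "(+) a ` {k. k < b - a \<and> P (xs ! (a + k))} = {t \<in> {a..<b}. P (xs ! t)}"
  proof (intro equalityI subsetI)
    fix t assume "t \<in> {t \<in> {a..<b}. P (xs ! t)}"
    then have "t = a + (t - a)" "t - a < b - a" "P (xs ! (a + (t - a)))" by auto
    then show "t \<in> (+) a ` {k. k < b - a \<and> P (xs ! (a + k))}" by blast
  qed auto
  finally show ?thesis .
qed

lemma length_filter_majority:
  assumes "tournament_on Q V" "x \<in> V" "set vs \<subseteq> V" "x \<notin> set vs"
  shows "length (filter (Q x) vs) + length (filter (\<lambda>v. Q v x) vs) = length vs"
  using assms(3,4)
proof (induction vs)
  case (Cons v vs)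
  from Cons.prems have "v \<in> V" "x \<noteq> v" by auto
  then have "Q x v \<longleftrightarrow> \<not> Q v x" using assms(1,2) unfolding tournament_on_def by blast
  with Cons show ?case by auto
qed simp

text \<open>An ordering with the maximum number of forward arcs: moving one vertex cannot gain.\<close>

lemma median_order_exists:
  assumes "finite V" "tournament_on Q V"
  obtains e where "bij_betw e {..<card V} V"
    and "median_order (\<lambda>i j. Q (e i) (e j)) (card V)"
proof -
  let ?P = "\<lambda>xs. distinct xs \<and> set xs = V"
  obtain xs0 where xs0: "?P xs0" using finite_distinct_list[OF assms(1)] by blast
  have "\<forall>ys. ?P ys \<longrightarrow> forward_arcs Q ys < Suc (card V * card V)"
    using forward_arcs_le[of Q] by (metis distinct_card le_imp_less_Suc)
  then obtain xs where xs: "?P xs"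
    and mx: "\<And>ys. ?P ys \<Longrightarrow> forward_arcs Q ys \<le> forward_arcs Q xs"
    using ex_has_greatest_nat[of ?P xs0 "forward_arcs Q"] xs0 by blast
  let ?N = "card V" and ?e = "(!) xs"
  have len: "length xs = ?N" using xs distinct_card[of xs] by simp
  have bij: "bij_betw ?e {..<?N} V" using xs len by (intro bij_betw_nth) auto
  have t: "tournament_on (\<lambda>i j. Q (?e i) (?e j)) {..<?N}"
    unfolding tournament_on_def
  proof (intro ballI impI)
    fix i j assume h: "i \<in> {..<?N}" "j \<in> {..<?N}" "i \<noteq> j"
    then have "?e i \<in> V" "?e j \<in> V" "?e i \<noteq> ?e j"
      using bij by (auto simp: bij_betw_def inj_on_def)
    then show "Q (?e i) (?e j) \<longleftrightarrow> \<not> Q (?e j) (?e i)" using assms(2) unfolding tournament_on_def by blast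
  qed
  have fw: "j - Suc i \<le> 2 * card {t \<in> {i<..<j}. Q (?e i) (?e t)}" if "i < j" "j \<le> ?N" for i j
  proof -
    have "take j xs = take i xs @ xs ! i # drop (Suc i) (take j xs)"
      using that len by (subst id_take_nth_drop[of i "take j xs"]) (auto simp: min_def)
    then have "take j xs @ drop j xs = (take i xs @ xs ! i # drop (Suc i) (take j xs)) @ drop j xs"
      by (rule arg_cong[where f = "\<lambda>z. z @ drop j xs"])
    then obtain us x vs ws where split: "xs = us @ x # vs @ ws"
      and x: "x = xs ! i" and vs: "vs = drop (Suc i) (take j xs)"
      unfolding append_take_drop_id append_assoc append_Cons by blast
    have P: "?P (us @ vs @ x # ws)" and nin: "x \<notin> set vs" and V: "x \<in> V" "set vs \<subseteq> V"
      using xs unfolding split by auto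
    have "length (filter (\<lambda>v. Q v x) vs) \<le> length (filter (Q x) vs)"
      using mx[OF P] forward_arcs_move[of Q us x vs ws] unfolding split by linarith
    then have "length vs \<le> 2 * length (filter (Q x) vs)"
      using length_filter_majority[OF assms(2) V nin] by linarith
    also have "length (filter (Q x) vs) = card {t \<in> {Suc i..<j}. Q (?e i) (?e t)}"
      using that len unfolding vs x by (subst length_filter_segment) auto
    finally show ?thesis using that len by (simp add: vs atLeastSucLessThan_greaterThanLessThan)
  qed
  have bw: "j - i \<le> 2 * card {t \<in> {i..<j}. Q (?e t) (?e j)}" if "i \<le> j" "j < ?N" for i j
  proof -
    have "take j xs = take i xs @ drop i (take j xs)"
      using that by (subst append_take_drop_id[of i "take j xs", symmetric]) (auto simp: min_def)
    then have eq: "take j xs @ xs ! j # drop (Suc j) xs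
        = (take i xs @ drop i (take j xs)) @ xs ! j # drop (Suc j) xs"
      by (rule arg_cong[where f = "\<lambda>z. z @ xs ! j # drop (Suc j) xs"])
    have "take j xs @ xs ! j # drop (Suc j) xs = xs"
      using that len by (intro id_take_nth_drop[symmetric]) simp
    from this[symmetric] eq have "xs = (take i xs @ drop i (take j xs)) @ xs ! j # drop (Suc j) xs"
      by (rule trans)
    then obtain us x vs ws where split: "xs = us @ vs @ x # ws"
      and x: "x = xs ! j" and vs: "vs = drop i (take j xs)"
      unfolding append_assoc by blast
    have P: "?P (us @ x # vs @ ws)" and nin: "x \<notin> set vs" and V: "x \<in> V" "set vs \<subseteq> V"
      using xs unfolding split by auto
    have "length (filter (Q x) vs) \<le> length (filter (\<lambda>v. Q v x) vs)"
      using mx[OF P] forward_arcs_move[of Q us x vs ws] unfolding split by linarith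
    then have "length vs \<le> 2 * length (filter (\<lambda>v. Q v x) vs)"
      using length_filter_majority[OF assms(2) V nin] by linarith
    also have "length (filter (\<lambda>v. Q v x) vs) = card {t \<in> {i..<j}. Q (?e t) (?e j)}"
      using that len unfolding vs x by (subst length_filter_segment) auto
    finally show ?thesis using that len by (simp add: vs)
  qed
  from bij t fw bw show ?thesis by (intro that[of ?e]) (auto simp: median_order_def)
qed

section \<open>Arborescences in tournaments\<close>

text \<open>Nodes are numbers larger than their parents, so acyclicity is built in, and the least or
  largest node of a set has its parent or its children outside the set. The value \<open>p r\<close>
  has no meaning, hence the exclusion of \<open>r\<close> whenever parents are compared.\<close>

definition rooted_tree :: "nat set \<Rightarrow> nat \<Rightarrow> (nat \<Rightarrow> nat) \<Rightarrow> bool" where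
  "rooted_tree A r p \<longleftrightarrow> finite A \<and> r \<in> A \<and> (\<forall>x\<in>A - {r}. p x \<in> A \<and> p x < x)"

definition childless :: "nat set \<Rightarrow> nat \<Rightarrow> (nat \<Rightarrow> nat) \<Rightarrow> nat set" where
  "childless A r p = {x \<in> A. \<forall>y\<in>A - {r}. p y \<noteq> x}"

lemma Max_childless:
  assumes "rooted_tree A r p" shows "Max A \<in> childless A r p"
proof -
  have "finite A" "r \<in> A" using assms by (auto simp: rooted_tree_def)
  then have "Max A \<in> A" by (intro Max_in) auto
  moreover have "p y \<noteq> Max A" if "y \<in> A - {r}" for y
  proof -
    have "p y < y" using assms that by (auto simp: rooted_tree_def)
    moreover have "y \<le> Max A" using \<open>finite A\<close> that by auto
    ultimately show ?thesis by simp
  qed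
  ultimately show ?thesis by (auto simp: childless_def)
qed

lemma card_childless_pos:
  assumes "rooted_tree A r p" shows "0 < card (childless A r p)"
proof -
  have "finite (childless A r p)" using assms by (simp add: rooted_tree_def childless_def)
  then show ?thesis using Max_childless[OF assms] card_gt_0_iff by blast
qed

text \<open>
  State of a greedy embedding that scans a median order from left to right, after \<^term>\<open>i\<close> steps: each
  vertex dominated by the image of an active node (one that misses a child) becomes the image
  of a child of the active node with the leftmost such image.
\<close>

definition greedy_state ::
  "nat set \<Rightarrow> nat \<Rightarrow> (nat \<Rightarrow> nat) \<Rightarrow> (nat \<Rightarrow> nat \<Rightarrow> bool) \<Rightarrow> nat \<Rightarrow> nat set \<Rightarrow> (nat \<Rightarrow> nat) \<Rightarrow> bool" where
  "greedy_state A r p Q i S f \<longleftrightarrow>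
     (\<forall>x z j. x \<in> S \<and> z \<in> A - {r} \<and> z \<notin> S \<and> p z = x \<and> f x < j \<and> j < i \<and> Q (f x) j \<longrightarrow>
        (\<exists>y\<in>S - {r}. f y = j \<and> f (p y) \<le> f x)) \<and>
     (\<forall>j\<le>i. j \<le> card {x \<in> S. f x < j} + card {x \<in> S \<inter> childless A r p. f x < j})"

definition partial_embedding ::
  "nat set \<Rightarrow> nat \<Rightarrow> (nat \<Rightarrow> nat) \<Rightarrow> (nat \<Rightarrow> nat \<Rightarrow> bool) \<Rightarrow> nat \<Rightarrow> nat set \<Rightarrow> (nat \<Rightarrow> nat) \<Rightarrow> bool" where
  "partial_embedding A r p Q i S f \<longleftrightarrow> S \<subseteq> A \<and> r \<in> S \<and> inj_on f S \<and> f ` S \<subseteq> {..<i} \<and>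
     (\<forall>x\<in>S - {r}. p x \<in> S \<and> f (p x) < f x \<and> Q (f (p x)) (f x))"

text \<open>A hit uses position \<open>i\<close>, so no position is skipped; the second condition of
  \<open>greedy_state\<close> bounds the skipped positions below \<open>j\<close> by the childless
  images below \<open>j\<close>. Serving the leftmost dominating image preserves the first
  condition, as \<open>f (p z)\<close> is then at most \<open>f x\<close> for every active
  \<open>x\<close> that dominates \<open>i\<close>.\<close>

lemma greedy_step_hit:
  assumes t: "rooted_tree A r p" and pe: "partial_embedding A r p Q i S f"
    and gs: "greedy_state A r p Q i S f"
    and z: "z \<in> A - {r}" "z \<notin> S" "p z \<in> S" "Q (f (p z)) i"
    and mn: "\<And>z'. z' \<in> A - {r} \<Longrightarrow> z' \<notin> S \<Longrightarrow> p z' \<in> S \<Longrightarrow> Q (f (p z')) i \<Longrightarrow> f (p z) \<le> f (p z')"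
  shows "partial_embedding A r p Q (Suc i) (insert z S) (f(z := i))
       \<and> greedy_state A r p Q (Suc i) (insert z S) (f(z := i))"
proof
  let ?S = "insert z S" and ?f = "f(z := i)" and ?L = "childless A r p"
  have fin: "finite S" using t pe finite_subset unfolding rooted_tree_def partial_embedding_def by blast
  have lt: "f x < i" if "x \<in> S" for x using pe that by (auto simp: partial_embedding_def)
  have pS: "p x \<in> S" if "x \<in> S - {r}" for x using pe that by (auto simp: partial_embedding_def)
  have ne: "x \<noteq> z" if "x \<in> S" for x using z that by auto
  have "inj_on ?f ?S" using pe lt z(2)
    unfolding partial_embedding_def inj_on_def by (auto dest: less_imp_neq)
  moreover have "?f ` ?S \<subseteq> {..<Suc i}" using lt less_Suc_eq by auto
  moreover have "\<forall>x\<in>?S - {r}. p x \<in> ?S \<and> ?f (p x) < ?f x \<and> Q (?f (p x)) (?f x)"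
    using pe z lt[OF z(3)] ne[OF z(3)] ne pS unfolding partial_embedding_def by auto
  ultimately show "partial_embedding A r p Q (Suc i) ?S ?f"
    using pe z unfolding partial_embedding_def by blast
  have I1: "\<exists>y\<in>?S - {r}. ?f y = j \<and> ?f (p y) \<le> ?f x"
    if h: "x \<in> ?S" "c \<in> A - {r}" "c \<notin> ?S" "p c = x" "?f x < j" "j < Suc i" "Q (?f x) j" for x c j
  proof -
    have "x \<noteq> z" using h by auto
    then have x: "x \<in> S" "f x < j" "Q (f x) j" "c \<notin> S" using h by auto
    show ?thesis
    proof (cases "j = i")
      case True
      then have "f (p z) \<le> f x" using mn[of c] h x by auto
      then show ?thesis using True z \<open>x \<noteq> z\<close> ne[OF z(3)] by auto
    next
      case False
      then have "j < i" using h by auto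
      then obtain y where y: "y \<in> S - {r}" "f y = j" "f (p y) \<le> f x"
        using gs h x unfolding greedy_state_def by blast
      then show ?thesis using ne pS[OF y(1)] \<open>x \<noteq> z\<close> by (intro bexI[of _ y]) auto
    qed
  qed
  have I2: "j \<le> card {x \<in> ?S. ?f x < j} + card {x \<in> ?S \<inter> ?L. ?f x < j}" if "j \<le> Suc i" for j
  proof (cases "j = Suc i")
    case False
    then have j: "j \<le> i" using that by simp
    then have "{x \<in> ?S. ?f x < j} = {x \<in> S. f x < j}"
      "{x \<in> ?S \<inter> ?L. ?f x < j} = {x \<in> S \<inter> ?L. f x < j}" using ne by auto
    then show ?thesis using gs j unfolding greedy_state_def by auto
  next
    case True
    have "i \<le> card {x \<in> S. f x < i} + card {x \<in> S \<inter> ?L. f x < i}"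
      using gs unfolding greedy_state_def by blast
    also have "card {x \<in> S \<inter> ?L. f x < i} \<le> card {x \<in> ?S \<inter> ?L. ?f x < j}"
      using True ne fin by (intro card_mono) auto
    also have "{x \<in> ?S. ?f x < j} = insert z {x \<in> S. f x < i}"
      using True ne lt by (auto intro: less_SucI)
    then have "card {x \<in> ?S. ?f x < j} = Suc (card {x \<in> S. f x < i})"
      using fin z by simp
    ultimately show ?thesis using True by linarith
  qed
  show "greedy_state A r p Q (Suc i) ?S ?f"
    unfolding greedy_state_def using I1 I2 by blast
qed

text \<open>
  Let \<open>h\<close> be the rightmost image of an active node. If it does not dominate \<^term>\<open>i\<close>, then at least
  half of the vertices after \<open>h\<close> are images of nodes whose parents lie at \<open>h\<close> or before. The nodes
  placed after \<open>h\<close> form a forest in which these are roots, and a forest has at least as many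
  childless nodes as roots; they pay for the failures after \<open>h\<close>.
\<close>

lemma greedy_step_fail:
  assumes t: "rooted_tree A r p" and pe: "partial_embedding A r p Q i S f"
    and gs: "greedy_state A r p Q i S f" and med: "median_order Q N" and iN: "i < N"
    and z: "z \<in> A - {r}" "z \<notin> S" "p z \<in> S"
    and mx: "\<And>z'. z' \<in> A - {r} \<Longrightarrow> z' \<notin> S \<Longrightarrow> p z' \<in> S \<Longrightarrow> f (p z') \<le> f (p z)"
    and fail: "\<And>z'. z' \<in> A - {r} \<Longrightarrow> z' \<notin> S \<Longrightarrow> p z' \<in> S \<Longrightarrow> \<not> Q (f (p z')) i"
  shows "greedy_state A r p Q (Suc i) S f"
proof -
  let ?L = "childless A r p"
  define h where "h = f (p z)"
  have fin: "finite S" using t pe finite_subset unfolding rooted_tree_def partial_embedding_def by blast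
  have lt: "f x < i" if "x \<in> S" for x using pe that by (auto simp: partial_embedding_def)
  have pS: "p x \<in> S" "f (p x) < f x" if "x \<in> S - {r}" for x
    using pe that by (auto simp: partial_embedding_def)
  have inj: "inj_on f S" using pe by (auto simp: partial_embedding_def)
  have SA: "S \<subseteq> A" using pe by (auto simp: partial_embedding_def)
  have hi: "h < i" using lt[OF z(3)] h_def by simp
  define Y where "Y = {y \<in> S. h < f y}"
  define R where "R = {y \<in> Y - {r}. f (p y) \<le> h}"
  let ?O = "{t \<in> {h<..<Suc i}. Q h t}"
  have "h < Suc i \<and> Suc i \<le> N \<longrightarrow> Suc i - Suc h \<le> 2 * card ?O"
    using med unfolding median_order_def by blast
  then have "Suc i - Suc h \<le> 2 * card ?O" using hi iN by simp
  then have half: "i - h \<le> 2 * card ?O" by simp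
  have "?O \<subseteq> f ` R"
  proof
    fix t assume "t \<in> ?O"
    then have t: "h < t" "t < Suc i" "Q h t" by auto
    have "t \<noteq> i" using t fail[OF z] h_def by auto
    then have "t < i" using t by simp
    then obtain y where "y \<in> S - {r}" "f y = t" "f (p y) \<le> h"
      using gs z t h_def unfolding greedy_state_def by blast
    then show "t \<in> f ` R" using t unfolding R_def Y_def by auto
  qed
  moreover have finY: "finite Y" and finR: "finite R" using fin unfolding R_def Y_def by auto
  ultimately have OR: "card ?O \<le> card R" by (meson card_image_le card_mono finite_imageI le_trans)
  \<comment> \<open>A node of \<open>Y\<close> with a child has all its children placed, since
    otherwise it would be active with an image beyond \<open>h\<close>. Such a child lies after
    \<open>h\<close>, but its parent does too, so it is in \<open>Y\<close> and not in
    \<open>R\<close>.\<close>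
  have "Y - ?L \<subseteq> p ` (Y - R)"
  proof
    fix y assume y: "y \<in> Y - ?L"
    then obtain c where c: "c \<in> A - {r}" "p c = y" using SA unfolding childless_def Y_def by auto
    have "c \<in> S"
    proof (rule ccontr)
      assume "c \<notin> S"
      then have "f y \<le> h" using mx[of c] c y unfolding Y_def h_def by auto
      then show False using y unfolding Y_def by auto
    qed
    then have "c \<in> Y" "c \<notin> R" using c pS[of c] y unfolding R_def Y_def by auto
    then show "y \<in> p ` (Y - R)" using c by blast
  qed
  then have "card (Y - ?L) \<le> card (Y - R)"
    using finY by (meson card_image_le card_mono finite_Diff finite_imageI le_trans)
  moreover have "card (Y - ?L) + card (Y \<inter> ?L) = card Y"
    using card_Diff_subset_Int[of Y ?L] card_mono[of Y "Y \<inter> ?L"] finY by simp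
  moreover have "card (Y - R) + card R = card Y"
  proof -
    have "R \<subseteq> Y" unfolding R_def by auto
    then show ?thesis using finY finR card_Diff_subset[of R Y] card_mono[of Y R] by simp
  qed
  ultimately have RL: "card R \<le> card (Y \<inter> ?L)" by linarith
  have RY: "card R \<le> card Y" using finY unfolding R_def by (intro card_mono) auto
  have I2: "j \<le> card {x \<in> S. f x < j} + card {x \<in> S \<inter> ?L. f x < j}" if "j \<le> Suc i" for j
  proof (cases "j = Suc i")
    case False
    then show ?thesis using gs that unfolding greedy_state_def by auto
  next
    case True
    \<comment> \<open>The invariant is used at the earlier position \<open>h\<close>, which is why
      it is kept for all prefixes. Position \<open>h\<close> itself carries \<open>p z\<close>, and
      \<open>i - h \<le> 2 * card R \<le> card Y + card (Y \<inter> ?L)\<close> accounts for the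
      rest.\<close>
    have "h \<le> card {x \<in> S. f x < h} + card {x \<in> S \<inter> ?L. f x < h}"
      using gs hi unfolding greedy_state_def by auto
    moreover have "card {x \<in> S. f x < j} = card {x \<in> S. f x < h} + Suc (card Y)"
    proof -
      have "{x \<in> S. f x < j} = {x \<in> S. f x < h} \<union> insert (p z) Y"
        using True lt inj z(3) unfolding Y_def h_def inj_on_def
        by (auto simp: not_less_iff_gr_or_eq intro: less_SucI)
      moreover have "p z \<notin> Y" "{x \<in> S. f x < h} \<inter> insert (p z) Y = {}"
        unfolding Y_def h_def by auto
      ultimately show ?thesis using fin finY by (simp add: card_Un_disjoint)
    qed
    moreover have "card {x \<in> S \<inter> ?L. f x < h} + card (Y \<inter> ?L) \<le> card {x \<in> S \<inter> ?L. f x < j}"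
    proof -
      have "card ({x \<in> S \<inter> ?L. f x < h} \<union> (Y \<inter> ?L)) \<le> card {x \<in> S \<inter> ?L. f x < j}"
        using fin True lt unfolding Y_def h_def by (intro card_mono) (auto intro: less_SucI)
      moreover have "card ({x \<in> S \<inter> ?L. f x < h} \<union> (Y \<inter> ?L))
          = card {x \<in> S \<inter> ?L. f x < h} + card (Y \<inter> ?L)"
        using fin finY unfolding Y_def by (intro card_Un_disjoint) auto
      ultimately show ?thesis by simp
    qed
    ultimately show ?thesis using True half OR RL RY hi by linarith
  qed
  have I1: "\<exists>y\<in>S - {r}. f y = j \<and> f (p y) \<le> f x"
    if "x \<in> S" "c \<in> A - {r}" "c \<notin> S" "p c = x" "f x < j" "j < Suc i" "Q (f x) j" for x c j
  proof -
    have "j \<noteq> i" using fail[of c] that by auto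
    then have "j < i" using that by simp
    then show ?thesis using gs that unfolding greedy_state_def by blast
  qed
  show ?thesis unfolding greedy_state_def using I1 I2 by blast
qed

text \<open>Parents are smaller, so the least missing node has its parent in
  \<open>S\<close>.\<close>

lemma missing_child:
  assumes t: "rooted_tree A r p" and S: "S \<subseteq> A" "r \<in> S" "S \<noteq> A"
  obtains z where "z \<in> A - {r}" "z \<notin> S" "p z \<in> S"
proof -
  define z where "z = Min (A - S)"
  have fin: "finite (A - S)" and "A - S \<noteq> {}" using t S by (auto simp: rooted_tree_def)
  then have z: "z \<in> A - S" unfolding z_def by (rule Min_in)
  then have "p z \<in> A" "p z < z" using t S unfolding rooted_tree_def by blast+
  moreover have "p z \<in> S"
  proof (rule ccontr)
    assume "p z \<notin> S"
    then have "z \<le> p z" using fin \<open>p z \<in> A\<close> unfolding z_def by (intro Min_le) auto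
    then show False using \<open>p z < z\<close> by simp
  qed
  ultimately show ?thesis using that[of z] z S by blast
qed

text \<open>After completion the remaining positions are passed over without being paid for; this is
  why the state is claimed only as long as \<open>S\<close> differs from \<open>A\<close>.\<close>

lemma greedy_embedding:
  assumes t: "rooted_tree A r p" and med: "median_order Q N" and "Suc i \<le> N"
  shows "\<exists>S f. partial_embedding A r p Q (Suc i) S f \<and> (S = A \<or> greedy_state A r p Q (Suc i) S f)"
  using assms(3)
proof (induction i)
  case 0
  have "partial_embedding A r p Q (Suc 0) {r} (\<lambda>_. 0)"
    using t by (auto simp: partial_embedding_def rooted_tree_def)
  moreover have "greedy_state A r p Q (Suc 0) {r} (\<lambda>_. 0)"
    unfolding greedy_state_def
  proof (intro conjI allI impI)
    fix j :: nat assume "j \<le> Suc 0"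
    then have "j \<le> card {x \<in> {r}. 0 < j}" by (cases "j = 0") auto
    then show "j \<le> card {x \<in> {r}. 0 < j} + card {x \<in> {r} \<inter> childless A r p. 0 < j}"
      by (rule trans_le_add1)
  qed auto
  ultimately show ?case by blast
next
  case (Suc i)
  let ?i = "Suc i"
  obtain S f where pe: "partial_embedding A r p Q ?i S f"
    and gs: "S = A \<or> greedy_state A r p Q ?i S f" using Suc by auto
  have pe': "partial_embedding A r p Q (Suc ?i) S f"
    using pe less_SucI unfolding partial_embedding_def by (auto simp: less_Suc_eq)
  show ?case
  proof (cases "S = A")
    case True
    then show ?thesis using pe' by blast
  next
    case False
    then have gs: "greedy_state A r p Q ?i S f" using gs by simp
    have S: "S \<subseteq> A" "r \<in> S" using pe by (auto simp: partial_embedding_def)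
    let ?Z = "\<lambda>z. z \<in> A - {r} \<and> z \<notin> S \<and> p z \<in> S"
    show ?thesis
    proof (cases "\<exists>z. ?Z z \<and> Q (f (p z)) ?i")
      case True
      then obtain z0 where "?Z z0 \<and> Q (f (p z0)) ?i" by blast
      then obtain z where z: "?Z z \<and> Q (f (p z)) ?i"
        and mn: "\<And>z'. ?Z z' \<and> Q (f (p z')) ?i \<Longrightarrow> f (p z) \<le> f (p z')"
        using ex_has_least_nat[of "\<lambda>z. ?Z z \<and> Q (f (p z)) ?i" z0 "\<lambda>z. f (p z)"] by blast
      have "partial_embedding A r p Q (Suc ?i) (insert z S) (f(z := ?i))
       \<and> greedy_state A r p Q (Suc ?i) (insert z S) (f(z := ?i))"
        using z mn by (intro greedy_step_hit[OF t pe gs]) auto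
      then show ?thesis by blast
    next
      case fail: False
      obtain z0 where "?Z z0" using missing_child[OF t S False] by blast
      moreover have "\<forall>z. ?Z z \<longrightarrow> f (p z) < ?i" using pe by (auto simp: partial_embedding_def)
      ultimately obtain z where z: "?Z z" and mx: "\<And>z'. ?Z z' \<Longrightarrow> f (p z') \<le> f (p z)"
        using ex_has_greatest_nat[of ?Z z0 "\<lambda>z. f (p z)" ?i] by blast
      have "greedy_state A r p Q (Suc ?i) S f"
        using z mx fail Suc.prems by (intro greedy_step_fail[OF t pe gs med, of z]) auto
      then show ?thesis using pe' by blast
    qed
  qed
qed

text \<open>If nodes were missing after \<open>N\<close> steps, the largest of them would be
  childless. Both counts in the invariant would then fall short by at least one, so that
  \<open>N + 2 \<le> card A + card (childless A r p)\<close>.\<close>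

lemma arborescence_in_median_order:
  assumes t: "rooted_tree A r p" and med: "median_order Q N"
    and N: "card A + card (childless A r p) \<le> Suc N"
  obtains f where "inj_on f A" "f ` A \<subseteq> {..<N}" "\<And>x. x \<in> A - {r} \<Longrightarrow> Q (f (p x)) (f x)"
proof -
  let ?L = "childless A r p"
  have fin: "finite A" "finite ?L" "r \<in> A" using t by (auto simp: rooted_tree_def childless_def)
  have "0 < card A" using fin card_gt_0_iff by blast
  then have "0 < N" using N card_childless_pos[OF t] by linarith
  then obtain i where i: "N = Suc i" using gr0_implies_Suc by blast
  then obtain S f where pe: "partial_embedding A r p Q N S f"
    and gs: "S = A \<or> greedy_state A r p Q N S f" using greedy_embedding[OF t med, of i] by auto
  have S: "S \<subseteq> A" "r \<in> S" "\<And>x. x \<in> S \<Longrightarrow> f x < N" using pe by (auto simp: partial_embedding_def)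
  have "S = A"
  proof (rule ccontr)
    assume "S \<noteq> A"
    then have "greedy_state A r p Q N S f" using gs by simp
    then have le: "N \<le> card {x \<in> S. f x < N} + card {x \<in> S \<inter> ?L. f x < N}"
      unfolding greedy_state_def by blast
    define z where "z = Max (A - S)"
    have fin': "finite (A - S)" and "A - S \<noteq> {}" using fin S \<open>S \<noteq> A\<close> by auto
    then have z: "z \<in> A - S" unfolding z_def by (rule Max_in)
    have "z \<in> ?L"
      unfolding childless_def
    proof (intro CollectI conjI ballI)
      fix c assume c: "c \<in> A - {r}"
      then have lt: "p c < c" using t by (auto simp: rooted_tree_def)
      show "p c \<noteq> z"
      proof
        assume pz: "p c = z"
        have "c \<notin> S"
        proof
          assume "c \<in> S"
          then have "p c \<in> S" using pe c by (auto simp: partial_embedding_def)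
          then show False using pz z by simp
        qed
        then have "c \<le> z" using fin' c unfolding z_def by (intro Max_ge) auto
        then show False using pz lt by simp
      qed
    qed (use z in auto)
    have "card {x \<in> S. f x < N} < card A" using z S fin by (intro psubset_card_mono) auto
    moreover have "card {x \<in> S \<inter> ?L. f x < N} < card ?L"
      using z S fin \<open>z \<in> ?L\<close> by (intro psubset_card_mono) auto
    ultimately show False using le N by linarith
  qed
  then show ?thesis using pe that[of f] unfolding partial_embedding_def by blast
qed

lemma arborescence_in_tournament:
  assumes t: "rooted_tree A r p" and "finite V" "tournament_on Q V"
    and N: "card A + card (childless A r p) \<le> Suc (card V)"
  obtains f where "inj_on f A" "f ` A \<subseteq> V" "\<And>x. x \<in> A - {r} \<Longrightarrow> Q (f (p x)) (f x)"
proof -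
  obtain e where e: "bij_betw e {..<card V} V"
    and med: "median_order (\<lambda>i j. Q (e i) (e j)) (card V)" using median_order_exists assms(2,3) by metis
  obtain f where f: "inj_on f A" "f ` A \<subseteq> {..<card V}"
    and arc: "\<And>x. x \<in> A - {r} \<Longrightarrow> Q (e (f (p x))) (e (f x))"
    using arborescence_in_median_order[OF t med N] by metis
  have "inj_on e (f ` A)" using e f(2) inj_on_subset unfolding bij_betw_def by blast
  then have "inj_on (e \<circ> f) A" using f(1) by (rule comp_inj_on[rotated])
  moreover have "(e \<circ> f) ` A \<subseteq> V" using e f(2) unfolding bij_betw_def by auto
  ultimately show ?thesis using that[of "e \<circ> f"] arc by auto
qed

section \<open>Oriented trees in tournaments\<close>

lemma median_order_prefix: "median_order Q N \<Longrightarrow> M \<le> N \<Longrightarrow> median_order Q M"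
  unfolding median_order_def tournament_on_def by (meson less_le_trans lessThan_iff le_trans)

lemma tournament_on_converse: "tournament_on Q V \<Longrightarrow> tournament_on (\<lambda>x y. Q y x) V"
  unfolding tournament_on_def by blast

lemma tournament_on_subset: "tournament_on Q V \<Longrightarrow> W \<subseteq> V \<Longrightarrow> tournament_on Q W"
  unfolding tournament_on_def by blast

text \<open>Used to pick the leftmost free positions, so that the images of a piece crowd the end of
  the order as little as possible.\<close>

lemma initial_segment_of_card:
  fixes F :: "nat set"
  assumes "finite F" "s \<le> card F"
  obtains F' where "F' \<subseteq> F" "card F' = s" "\<And>t u. t \<in> F' \<Longrightarrow> u \<in> F \<Longrightarrow> u < t \<Longrightarrow> u \<in> F'"
proof -
  have "\<exists>F'\<subseteq>F. card F' = s \<and> (\<forall>t\<in>F'. \<forall>u\<in>F. u < t \<longrightarrow> u \<in> F')"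
    using assms(2)
  proof (induction s)
    case 0
    then show ?case by (intro exI[of _ "{}"]) auto
  next
    case (Suc s)
    then obtain F' where F': "F' \<subseteq> F" "card F' = s" "\<forall>t\<in>F'. \<forall>u\<in>F. u < t \<longrightarrow> u \<in> F'" by auto
    have fin: "finite F'" "finite (F - F')" using F'(1) assms(1) finite_subset by auto
    have "F - F' \<noteq> {}" using F' Suc.prems by auto
    define m where "m = Min (F - F')"
    have m: "m \<in> F - F'" using fin \<open>F - F' \<noteq> {}\<close> unfolding m_def by (intro Min_in)
    have "u \<in> F'" if "u \<in> F" "u < m" for u
    proof (rule ccontr)
      assume "u \<notin> F'"
      then have "m \<le> u" using that fin unfolding m_def by (intro Min_le) auto
      then show False using that by simp
    qed
    then show ?case using F' m fin by (intro exI[of _ "insert m F'"]) auto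
  qed
  then show ?thesis using that by blast
qed

text \<open>\<^term>\<open>up\<close> is the set of nodes whose parent arc points towards the root.\<close>

definition oriented_embedding ::
  "nat set \<Rightarrow> nat \<Rightarrow> (nat \<Rightarrow> nat) \<Rightarrow> nat set \<Rightarrow> ('v \<Rightarrow> 'v \<Rightarrow> bool) \<Rightarrow> 'v set \<Rightarrow> (nat \<Rightarrow> 'v) \<Rightarrow> bool" where
  "oriented_embedding A r p up Q V f \<longleftrightarrow> inj_on f A \<and> f ` A \<subseteq> V \<and>
     (\<forall>x\<in>A - {r}. if x \<in> up then Q (f x) (f (p x)) else Q (f (p x)) (f x))"

text \<open>When the tree is cut at the parent arcs of all nodes outside \<open>up\<close>, the
  pieces have all their arcs directed towards their roots, and these are the childless nodes of the
  pieces.\<close>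

definition no_up_child :: "nat set \<Rightarrow> nat \<Rightarrow> (nat \<Rightarrow> nat) \<Rightarrow> nat set \<Rightarrow> nat set" where
  "no_up_child A r p up = {x \<in> A. \<forall>y\<in>A - {r}. p y = x \<longrightarrow> y \<notin> up}"

section \<open>Cutting off a piece and finding room for it\<close>

lemma subtree_exists:
  assumes t: "rooted_tree A r p" and x0: "x0 \<in> A - {r}"
  obtains W where "rooted_tree W x0 p" "rooted_tree (A - W) r p" "W \<subseteq> A"
    and "\<And>y. y \<in> A - {r} \<Longrightarrow> p y \<in> W \<Longrightarrow> y \<in> W" "\<And>y. y \<in> W \<Longrightarrow> x0 \<le> y"
proof -
  define R where "R = {(x, p x) | x. x \<in> A - {r}}"
  define W where "W = {x \<in> A. (x, x0) \<in> R\<^sup>*}"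
  have step: "p y \<in> W" "x0 < y" "y \<noteq> r" if y: "y \<in> W" "y \<noteq> x0" for y
  proof -
    have "(y, x0) \<in> R\<^sup>*" using y W_def by auto
    then obtain z where "(y, z) \<in> R" "(z, x0) \<in> R\<^sup>*" using y(2) by (metis converse_rtranclE)
    then have z: "y \<in> A - {r}" "(p y, x0) \<in> R\<^sup>*" unfolding R_def by auto
    then show "p y \<in> W" "y \<noteq> r" using t unfolding W_def rooted_tree_def by auto
    have "x0 \<le> p y"
      using z(2)
    proof (induction rule: converse_rtrancl_induct)
      case (step a b)
      then have "a \<in> A - {r}" "b = p a" unfolding R_def by auto
      then have "b < a" using t by (auto simp: rooted_tree_def)
      then show ?case using step.IH by simp
    qed simp
    moreover have "p y < y" using t z(1) by (auto simp: rooted_tree_def)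
    ultimately show "x0 < y" by simp
  qed
  have closed: "y \<in> W" if "y \<in> A - {r}" "p y \<in> W" for y
  proof -
    have "(y, p y) \<in> R" "(p y, x0) \<in> R\<^sup>*" using that unfolding R_def W_def by auto
    then have "(y, x0) \<in> R\<^sup>*" by (rule converse_rtrancl_into_rtrancl)
    then show ?thesis using that(1) unfolding W_def by simp
  qed
  have WA: "W \<subseteq> A" and x0W: "x0 \<in> W" using x0 unfolding W_def by auto
  have rW: "r \<notin> W" using step(3)[of r] x0 by auto
  have "rooted_tree W x0 p"
    using t WA x0W step finite_subset unfolding rooted_tree_def by blast
  moreover have "rooted_tree (A - W) r p"
    using t rW closed unfolding rooted_tree_def by blast
  moreover have "x0 \<le> y" if "y \<in> W" for y using step(2)[OF that] by fastforce
  ultimately show ?thesis using that[of W, OF _ _ WA closed] by blast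
qed

lemma childless_subset_no_up_child: "childless A r p \<subseteq> no_up_child A r p up"
  unfolding childless_def no_up_child_def by blast

text \<open>At least half of the \<open>N0 + 2 * k - v - 1\<close> positions after \<open>v\<close>
  are out-neighbours, and by \<open>inv\<close> at most \<open>(N0 - v) / 2\<close> of them are
  occupied. The difference is at least \<open>k - 1/2\<close>, hence at least \<open>k\<close> by
  integrality: two positions buy one free neighbour.\<close>

lemma free_out_neighbours:
  fixes f :: "nat \<Rightarrow> nat"
  assumes med: "median_order Q N" and "finite B" and fB: "f ` B \<subseteq> {..<N0}" and v: "v < N0"
    and inv: "2 * card {x \<in> B. Suc v \<le> f x} \<le> N0 - Suc v + 1"
    and k: "N0 + 2 * k \<le> N"
  shows "k \<le> card {t \<in> {v<..<N0 + 2 * k}. Q v t \<and> t \<notin> f ` B}"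
proof -
  let ?O = "{t \<in> {v<..<N0 + 2 * k}. Q v t}" and ?I = "{x \<in> B. Suc v \<le> f x}"
  let ?F = "{t \<in> {v<..<N0 + 2 * k}. Q v t \<and> t \<notin> f ` B}"
  have "v < N0 + 2 * k \<and> N0 + 2 * k \<le> N \<longrightarrow> N0 + 2 * k - Suc v \<le> 2 * card ?O"
    using med unfolding median_order_def by blast
  then have O: "N0 + 2 * k - Suc v \<le> 2 * card ?O" using v k by simp
  have fin: "finite ?F" by (rule finite_subset[of _ "{v<..<N0 + 2 * k}"]) auto
  have "?O \<subseteq> ?F \<union> f ` ?I" by auto
  then have "card ?O \<le> card (?F \<union> f ` ?I)" using fin assms(2) by (intro card_mono) auto
  also have "\<dots> \<le> card ?F + card (f ` ?I)" by (rule card_Un_le)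
  also have "card (f ` ?I) \<le> card ?I" using assms(2) by (intro card_image_le) auto
  finally show ?thesis using O inv v by linarith
qed

text \<open>
  The invariant \<^term>\<open>2 * card {x \<in> A. j \<le> f x} \<le> N - j + 1\<close> leaves enough free vertices after
  each embedded node to attach a further subtree.
\<close>

lemma oriented_tree_in_median_order:
  assumes "rooted_tree A r p" "median_order Q N"
    and "2 * card A + 2 * card (no_up_child A r p up) \<le> N + 2 * card (A - {r} - up) + 3"
  shows "\<exists>f. oriented_embedding A r p up Q {..<N} f
           \<and> (\<forall>j\<le>N. 2 * card {x \<in> A. j \<le> f x} \<le> N - j + 1)"
  using assms
proof (induction "card (A - {r} - up)" arbitrary: A N)
  case 0
  note t = \<open>rooted_tree A r p\<close>
  have fin: "finite A" and rA: "r \<in> A" using t by (auto simp: rooted_tree_def)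
  have D: "A - {r} - up = {}" using 0(1) fin by simp
  then have E: "no_up_child A r p up = childless A r p"
    unfolding no_up_child_def childless_def by blast
  \<comment> \<open>The piece at the root goes into the first \<open>s\<close> positions of the
    reversed tournament. For the tail bound it needs only \<open>2 * s - 1\<close> positions, one
    less than the other pieces, which makes the constant in the requirement 3 and not 2.\<close>
  define s where "s = card A + card (childless A r p) - 1"
  have pos: "0 < card A" "0 < card (childless A r p)"
    using fin rA card_childless_pos[OF t] card_gt_0_iff by blast+
  have sN: "2 * s \<le> N + 1" "1 \<le> s" using 0(4) pos unfolding E D s_def by simp_all
  then have "s \<le> N" by linarith
  have "tournament_on Q {..<N}" using 0(3) unfolding median_order_def by blast
  then have tn: "tournament_on (\<lambda>x y. Q y x) {..<s}"
    using \<open>s \<le> N\<close> by (intro tournament_on_converse[OF tournament_on_subset[of Q "{..<N}"]]) auto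
  have cnt: "card A + card (childless A r p) \<le> Suc (card {..<s})" using s_def by simp
  obtain f where f: "inj_on f A" "f ` A \<subseteq> {..<s}" "\<And>x. x \<in> A - {r} \<Longrightarrow> Q (f x) (f (p x))"
    using arborescence_in_tournament[OF t finite_lessThan tn cnt] by blast
  have "oriented_embedding A r p up Q {..<N} f"
    using f D \<open>s \<le> N\<close> unfolding oriented_embedding_def by auto
  moreover have "2 * card {x \<in> A. j \<le> f x} \<le> N - j + 1" if "j \<le> N" for j
  proof -
    have "card {x \<in> A. j \<le> f x} = card (f ` {x \<in> A. j \<le> f x})"
      using f(1) by (intro card_image[symmetric]) (auto simp: inj_on_def)
    also have "\<dots> \<le> card {j..<s}" using f(2) by (intro card_mono) auto
    finally show ?thesis using sN that by auto
  qed
  ultimately show ?case by blast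
next
  case (Suc d)
  note t = \<open>rooted_tree A r p\<close> and med = \<open>median_order Q N\<close>
  let ?D = "A - {r} - up" and ?E = "no_up_child A r p up"
  have fin: "finite A" and rA: "r \<in> A" using t by (auto simp: rooted_tree_def)
  \<comment> \<open>No node below the last node outside \<^term>\<open>up\<close> is outside \<^term>\<open>up\<close>: its subtree is an in-arborescence.\<close>
  define x0 where "x0 = Max ?D"
  have finD: "finite ?D" using fin by simp
  have "?D \<noteq> {}" using Suc(2) by (metis card.empty nat.distinct(1))
  with finD have x0: "x0 \<in> ?D" unfolding x0_def by (rule Max_in)
  then obtain W where W: "rooted_tree W x0 p" "rooted_tree (A - W) r p" "W \<subseteq> A"
    and down: "\<And>y. y \<in> A - {r} \<Longrightarrow> p y \<in> W \<Longrightarrow> y \<in> W" and ge: "\<And>y. y \<in> W \<Longrightarrow> x0 \<le> y"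
    using subtree_exists[OF t, of x0] by blast
  have rW: "r \<notin> W" and x0W: "x0 \<in> W" using W by (auto simp: rooted_tree_def)
  have up: "y \<in> up" if "y \<in> W - {x0}" for y
  proof (rule ccontr)
    assume "y \<notin> up"
    then have "y \<le> x0" using that W(3) rW finD unfolding x0_def by (intro Max_ge) auto
    then show False using ge[of y] that by auto
  qed
  have par: "p y \<in> W" if "y \<in> W - {x0}" for y using W(1) that by (auto simp: rooted_tree_def)
  have D': "(A - W) - {r} - up = ?D - {x0}" using up x0W by blast
  then have cD: "card ?D = Suc (card ((A - W) - {r} - up))" using x0 finD
    by (metis card_Suc_Diff1)
  have E': "no_up_child (A - W) r p up = ?E - W"
    unfolding no_up_child_def using x0 par by blast
  have L: "childless W x0 p = ?E \<inter> W"
    unfolding no_up_child_def childless_def using up down W(3) rW x0 by blast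
  have finE: "finite ?E" using fin unfolding no_up_child_def by auto
  have cE: "card ?E = card (?E \<inter> W) + card (?E - W)"
    using finE by (metis card_Diff_subset_Int card_mono finite_Int inf_le1 le_add_diff_inverse)
  have cA: "card A = card W + card (A - W)"
    using fin W(3) by (metis card_Diff_subset card_mono finite_subset le_add_diff_inverse)
  \<comment> \<open>\<open>s\<close> vertices suffice for the arborescence on \<open>W\<close>;
    reserving the last \<open>2 * s\<close> positions guarantees that many free out-neighbours of
    the image of \<open>p x0\<close>.\<close>
  define s where "s = card W + card (?E \<inter> W) - 1"
  define N0 where "N0 = N - 2 * s"
  have "0 < card (?E \<inter> W)" using card_childless_pos[OF W(1)] L by simp
  then have s: "s + 1 = card W + card (?E \<inter> W)" "card W \<le> s" unfolding s_def by auto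
  have "0 < card (?E - W)"
  proof -
    have "card (childless (A - W) r p) \<le> card (?E - W)"
      using finE childless_subset_no_up_child[of "A - W" r p up] unfolding E' by (intro card_mono) auto
    then show ?thesis using card_childless_pos[OF W(2)] by linarith
  qed
  moreover have "card ((A - W) - {r} - up) < card (A - W)"
    using rA rW fin by (intro psubset_card_mono) auto
  ultimately have N0: "N = N0 + 2 * s"
    using Suc.prems(3) cD cA cE s unfolding N0_def by linarith
  have req: "2 * card (A - W) + 2 * card (no_up_child (A - W) r p up)
      \<le> N0 + 2 * card ((A - W) - {r} - up) + 3"
    using Suc.prems(3) cD cA cE s N0 unfolding E' by linarith
  obtain f where f: "oriented_embedding (A - W) r p up Q {..<N0} f"
    and inv: "\<And>j. j \<le> N0 \<Longrightarrow> 2 * card {x \<in> A - W. j \<le> f x} \<le> N0 - j + 1"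
    using Suc.hyps(1)[OF _ W(2) median_order_prefix[OF med] req] Suc.hyps(2) cD N0 by auto
  define v where "v = f (p x0)"
  have px0: "p x0 \<in> A - W"
  proof -
    have "p x0 \<in> A" "p x0 < x0" using t x0 by (auto simp: rooted_tree_def)
    then show ?thesis using ge[of "p x0"] by auto
  qed
  then have v: "v < N0" using f unfolding v_def oriented_embedding_def by auto
  define F where "F = {t \<in> {v<..<N}. Q v t \<and> t \<notin> f ` (A - W)}"
  \<comment> \<open>Needed for every \<open>k\<close> up to \<open>s\<close>, since the tail bound
    has to be restored at each position beyond \<open>N0\<close>.\<close>
  have free: "k \<le> card {t \<in> F. t < N0 + 2 * k}" if "k \<le> s" for k
  proof -
    have "k \<le> card {t \<in> {v<..<N0 + 2 * k}. Q v t \<and> t \<notin> f ` (A - W)}"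
      using fin f v inv[of "Suc v"] that N0
      by (intro free_out_neighbours[OF med]) (auto simp: oriented_embedding_def)
    also have "{t \<in> {v<..<N0 + 2 * k}. Q v t \<and> t \<notin> f ` (A - W)} = {t \<in> F. t < N0 + 2 * k}"
      using that N0 unfolding F_def by auto
    finally show ?thesis .
  qed
  have finF: "finite F" unfolding F_def by (rule finite_subset[of _ "{v<..<N}"]) auto
  have "s \<le> card F" using free[of s] card_mono[OF finF, of "{t \<in> F. t < N0 + 2 * s}"] by auto
  then obtain F' where F': "F' \<subseteq> F" "card F' = s"
    and init: "\<And>t u. t \<in> F' \<Longrightarrow> u \<in> F \<Longrightarrow> u < t \<Longrightarrow> u \<in> F'"
    using initial_segment_of_card[OF finF] by metis
  have finF': "finite F'" using F'(1) finF by (rule finite_subset)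
  have init_card: "k \<le> card {t \<in> F'. t < N0 + 2 * k}" if "k \<le> s" for k
  proof (cases "{t \<in> F. t < N0 + 2 * k} \<subseteq> F'")
    case True
    then have "{t \<in> F. t < N0 + 2 * k} = {t \<in> F'. t < N0 + 2 * k}" using F' by auto
    then show ?thesis using free[OF that] by simp
  next
    case False
    then obtain u where u: "u \<in> F" "u < N0 + 2 * k" "u \<notin> F'" by auto
    have "t < N0 + 2 * k" if "t \<in> F'" for t
      using init[OF that u(1)] u by (meson le_less_trans not_le_imp_less)
    then have "{t \<in> F'. t < N0 + 2 * k} = F'" by auto
    then show ?thesis using F' that by simp
  qed
  have "tournament_on Q {..<N}" using med unfolding median_order_def by blast
  then have tn: "tournament_on (\<lambda>x y. Q y x) F'"
    using F'(1) unfolding F_def by (intro tournament_on_converse[OF tournament_on_subset[of Q "{..<N}"]]) auto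
  have cnt: "card W + card (childless W x0 p) \<le> Suc (card F')" using F'(2) s(1) L by simp
  obtain g where g: "inj_on g W" "g ` W \<subseteq> F'"
    "\<And>x. x \<in> W - {x0} \<Longrightarrow> Q (g x) (g (p x))"
    using arborescence_in_tournament[OF W(1) finF' tn cnt] by blast
  define h where "h = (\<lambda>x. if x \<in> W then g x else f x)"
  have gF: "g x \<in> F" if "x \<in> W" for x using g(2) F'(1) that by auto
  have inj: "inj_on h A"
  proof (rule inj_onI)
    fix x y assume xy: "x \<in> A" "y \<in> A" "h x = h y"
    show "x = y"
    proof (cases "x \<in> W"; cases "y \<in> W")
      assume "x \<in> W" "y \<in> W"
      then show ?thesis using g(1) xy by (auto simp: h_def inj_on_def)
    next
      assume "x \<in> W" "y \<notin> W"
      then have "g x = f y" "g x \<in> F" using xy gF[of x] by (auto simp: h_def)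
      then show ?thesis using xy \<open>y \<notin> W\<close> unfolding F_def by auto
    next
      assume "x \<notin> W" "y \<in> W"
      then have "g y = f x" "g y \<in> F" using xy gF[of y] by (auto simp: h_def)
      then show ?thesis using xy \<open>x \<notin> W\<close> unfolding F_def by auto
    next
      assume "x \<notin> W" "y \<notin> W"
      then show ?thesis using f xy by (auto simp: h_def oriented_embedding_def inj_on_def)
    qed
  qed
  moreover have "h ` A \<subseteq> {..<N}"
    using f gF N0 unfolding h_def oriented_embedding_def F_def by fastforce
  moreover have "if x \<in> up then Q (h x) (h (p x)) else Q (h (p x)) (h x)" if x: "x \<in> A - {r}" for x
  proof (cases "x \<in> W")
    case False
    then have "p x \<notin> W" using down x by blast
    then show ?thesis using False x f unfolding h_def oriented_embedding_def by auto
  next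
    case True
    show ?thesis
    proof (cases "x = x0")
      case True
      then show ?thesis using x0 x0W px0 gF[OF x0W] unfolding h_def F_def v_def by auto
    next
      case False
      then show ?thesis using True up[of x] par[of x] g(3)[of x] unfolding h_def by auto
    qed
  qed
  ultimately have emb: "oriented_embedding A r p up Q {..<N} h"
    unfolding oriented_embedding_def by blast
  have "2 * card {x \<in> A. j \<le> h x} \<le> N - j + 1" if j: "j \<le> N" for j
  proof -
    let ?B = "{x \<in> A - W. j \<le> f x}" and ?C = "{x \<in> W. j \<le> g x}"
    have finW: "finite W" using fin W(3) finite_subset by blast
    have "{x \<in> A. j \<le> h x} = ?B \<union> ?C" using W(3) unfolding h_def by auto
    then have le: "card {x \<in> A. j \<le> h x} \<le> card ?B + card ?C" by (simp add: card_Un_le)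
    show ?thesis
    proof (cases "j \<le> N0")
      case True
      have "card ?C \<le> card W" using finW by (intro card_mono) auto
      then show ?thesis using le inv[OF True] s(2) N0 True by linarith
    next
      case False
      have "?B = {}" using f False unfolding oriented_embedding_def by auto
      then have "card ?B = 0" by (simp only: card.empty)
      moreover have "card ?C = card (g ` ?C)"
        using g(1) by (intro card_image[symmetric]) (auto simp: inj_on_def)
      moreover have "card (g ` ?C) \<le> card {t \<in> F'. j \<le> t}"
        using g(2) finF' by (intro card_mono) auto
      moreover have "card {t \<in> F'. j \<le> t} + card {t \<in> F'. t < j} = s"
      proof -
        have "card ({t \<in> F'. j \<le> t} \<union> {t \<in> F'. t < j}) = card {t \<in> F'. j \<le> t} + card {t \<in> F'. t < j}"
          using finF' by (intro card_Un_disjoint) auto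
        moreover have "{t \<in> F'. j \<le> t} \<union> {t \<in> F'. t < j} = F'" by auto
        ultimately show ?thesis using F'(2) by simp
      qed
      \<comment> \<open>At least \<open>k\<close> elements of \<open>F'\<close> lie below
        \<open>N0 + 2 * k\<close>, so at most \<open>s - k\<close> lie at \<open>j\<close> or later.
        Rounding \<open>j - N0\<close> down to an even number is absorbed by the \<open>+ 1\<close>
        of the invariant.\<close>
      moreover define k where "k = (j - N0) div 2"
      moreover have k: "k \<le> s" "N0 + 2 * k \<le> j" "j \<le> N0 + 2 * k + 1" using j N0 False k_def by auto
      moreover have "card {t \<in> F'. t < N0 + 2 * k} \<le> card {t \<in> F'. t < j}"
        using finF' k by (intro card_mono) auto
      ultimately show ?thesis using le init_card[OF k(1)] N0 False j by linarith
    qed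
  qed
  then show ?case using emb by blast
qed

lemma oriented_tree_in_tournament_forward:
  assumes t: "rooted_tree A r p" and V: "finite V" "tournament_on Q V"
    and N: "2 * card A + 2 * card (no_up_child A r p up) \<le> card V + 2 * card (A - {r} - up) + 3"
  obtains f where "oriented_embedding A r p up Q V f"
proof -
  obtain e where e: "bij_betw e {..<card V} V"
    and med: "median_order (\<lambda>i j. Q (e i) (e j)) (card V)" using median_order_exists V by metis
  obtain f where f: "oriented_embedding A r p up (\<lambda>i j. Q (e i) (e j)) {..<card V} f"
    using oriented_tree_in_median_order[OF t med N] by metis
  have sub: "f ` A \<subseteq> {..<card V}" and inj: "inj_on f A" using f by (auto simp: oriented_embedding_def)
  have "inj_on e (f ` A)" using e sub inj_on_subset unfolding bij_betw_def by blast
  then have "inj_on (e \<circ> f) A" using inj by (rule comp_inj_on[rotated])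
  moreover have "(e \<circ> f) ` A \<subseteq> V" using e sub unfolding bij_betw_def by auto
  ultimately show ?thesis using that[of "e \<circ> f"] f unfolding oriented_embedding_def by auto
qed

text \<open>The requirements for the tree in \<^term>\<open>Q\<close> and for its reversal in the reversed tournament are averaged.\<close>

lemma oriented_tree_in_tournament:
  assumes t: "rooted_tree A r p" and V: "finite V" "tournament_on Q V"
    and N: "2 * card A + card (childless A r p) \<le> card V + 2"
  obtains f where "oriented_embedding A r p up Q V f"
proof (cases "2 * card A + 2 * card (no_up_child A r p up) \<le> card V + 2 * card (A - {r} - up) + 3")
  case True
  then show ?thesis using oriented_tree_in_tournament_forward[OF t V] that by blast
next
  case False
  let ?E = "no_up_child A r p up" and ?E' = "no_up_child A r p (- up)"
  have fin: "finite A" "finite ?E" "finite ?E'" and rA: "r \<in> A"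
    using t by (auto simp: rooted_tree_def no_up_child_def)
  \<comment> \<open>Only a childless node lacks both kinds of children, so every other node is
    counted at most once.\<close>
  have "?E \<inter> ?E' = childless A r p" "?E \<union> ?E' \<subseteq> A"
    unfolding no_up_child_def childless_def by blast+
  then have E: "card ?E + card ?E' \<le> card A + card (childless A r p)"
    using card_Un_Int[of ?E ?E'] card_mono[of A "?E \<union> ?E'"] fin by simp
  have "(A - {r} - up) \<union> (A - {r} - - up) = A - {r}" by blast
  moreover have "card ((A - {r} - up) \<union> (A - {r} - - up)) = card (A - {r} - up) + card (A - {r} - - up)"
    using fin by (intro card_Un_disjoint) auto
  ultimately have D: "card (A - {r} - up) + card (A - {r} - - up) + 1 = card A"
    using fin rA by (metis One_nat_def Suc_eq_plus1 card_Suc_Diff1)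
  \<comment> \<open>If both requirements failed, their sum would give
    \<open>card V + 3 \<le> 2 * card A + card (childless A r p)\<close>.\<close>
  have "2 * card A + 2 * card ?E' \<le> card V + 2 * card (A - {r} - - up) + 3"
    using False E D N by linarith
  then obtain f where "oriented_embedding A r p (- up) (\<lambda>x y. Q y x) V f"
    using oriented_tree_in_tournament_forward[OF t V(1) tournament_on_converse[OF V(2)]] by blast
  then have "oriented_embedding A r p up Q V f" unfolding oriented_embedding_def by auto
  then show ?thesis by (rule that)
qed

section \<open>Attaching leaves\<close>

text \<open>The argument of Halmos and Vaughan: split at a tight proper subfamily, or else remove one element.\<close>

lemma Hall_marriage:
  assumes "finite I" "\<And>i. i \<in> I \<Longrightarrow> finite (S i)"
    and "\<And>J. J \<subseteq> I \<Longrightarrow> card J \<le> card (\<Union> (S ` J))"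
  shows "\<exists>R. inj_on R I \<and> (\<forall>i\<in>I. R i \<in> S i)"
  using assms
proof (induction "card I" arbitrary: I S rule: less_induct)
  case less
  note fin = less.prems(1,2) and hall = less.prems(3)
  show ?case
  proof (cases "\<exists>J. J \<subset> I \<and> J \<noteq> {} \<and> card (\<Union> (S ` J)) \<le> card J")
    case True
    then obtain J where J: "J \<subset> I" "J \<noteq> {}" "card (\<Union> (S ` J)) \<le> card J" by blast
    define U where "U = \<Union> (S ` J)"
    have finJ: "finite J" using J fin(1) finite_subset by blast
    have finU: "finite U" using finJ J fin unfolding U_def by auto
    have cJ: "card J < card I" using J fin by (intro psubset_card_mono)
    have "\<exists>R. inj_on R J \<and> (\<forall>i\<in>J. R i \<in> S i)"
      using J(1) by (intro less.hyps[OF cJ finJ] fin(2) hall) auto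
    then obtain R1 where R1: "inj_on R1 J" "\<And>i. i \<in> J \<Longrightarrow> R1 i \<in> S i" by blast
    have cIJ: "card (I - J) < card I"
      using J fin(1) by (intro psubset_card_mono) auto
    have "\<exists>R. inj_on R (I - J) \<and> (\<forall>i\<in>I - J. R i \<in> S i - U)"
    proof (rule less.hyps[OF cIJ])
      fix K assume K: "K \<subseteq> I - J"
      have finK: "finite K" using K fin(1) finite_subset by blast
      have "card K + card J = card (K \<union> J)" using K finK finJ by (intro card_Un_disjoint[symmetric]) auto
      also have "\<dots> \<le> card (\<Union> (S ` (K \<union> J)))" using K J by (intro hall) auto
      also have "\<Union> (S ` (K \<union> J)) = \<Union> ((\<lambda>i. S i - U) ` K) \<union> U" unfolding U_def by auto
      also have "card \<dots> \<le> card (\<Union> ((\<lambda>i. S i - U) ` K)) + card U" by (rule card_Un_le)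
      finally show "card K \<le> card (\<Union> ((\<lambda>i. S i - U) ` K))" using J(3) unfolding U_def by linarith
    qed (use fin in auto)
    then obtain R2 where R2: "inj_on R2 (I - J)" "\<And>i. i \<in> I - J \<Longrightarrow> R2 i \<in> S i - U" by blast
    define R where "R = (\<lambda>i. if i \<in> J then R1 i else R2 i)"
    have U1: "R1 i \<in> U" if "i \<in> J" for i using R1(2)[OF that] that unfolding U_def by auto
    have "inj_on R I"
    proof (rule inj_onI)
      fix x y assume xy: "x \<in> I" "y \<in> I" "R x = R y"
      have "x \<in> J \<longleftrightarrow> y \<in> J"
        using xy U1[of x] U1[of y] R2(2)[of x] R2(2)[of y] unfolding R_def by (auto split: if_splits)
      then show "x = y" using xy R1(1) R2(1) unfolding R_def inj_on_def by (auto split: if_splits)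
    qed
    moreover have "\<forall>i\<in>I. R i \<in> S i" using R1(2) R2(2) unfolding R_def by auto
    ultimately show ?thesis by blast
  next
    case tight: False
    show ?thesis
    proof (cases "I = {}")
      case False
      then obtain i where i: "i \<in> I" by blast
      have "card {i} \<le> card (S i)" using hall[of "{i}"] i by simp
      then have "S i \<noteq> {}" by auto
      then obtain a where a: "a \<in> S i" by blast
      have ci: "card (I - {i}) < card I" using i fin(1) by (intro psubset_card_mono) auto
      have "\<exists>R. inj_on R (I - {i}) \<and> (\<forall>k\<in>I - {i}. R k \<in> S k - {a})"
      proof (rule less.hyps[OF ci])
        fix K assume K: "K \<subseteq> I - {i}"
        show "card K \<le> card (\<Union> ((\<lambda>k. S k - {a}) ` K))"
        proof (cases "K = {}")
          case False
          have "K \<subset> I" using K i by blast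
          with False have "card K < card (\<Union> (S ` K))" using tight not_le by blast
          also have "\<dots> \<le> card (insert a (\<Union> ((\<lambda>k. S k - {a}) ` K)))"
            using K fin finite_subset[OF K] by (intro card_mono) auto
          also have "\<dots> \<le> Suc (card (\<Union> ((\<lambda>k. S k - {a}) ` K)))" by (rule card_insert_le_m1) auto
          finally show ?thesis by simp
        qed simp
      qed (use fin in auto)
      then obtain R where R: "inj_on R (I - {i})" "\<And>k. k \<in> I - {i} \<Longrightarrow> R k \<in> S k - {a}" by blast
      have "inj_on (R(i := a)) I"
        using R(1) R(2) by (intro inj_onI) (auto simp: inj_on_def split: if_splits)
      moreover have "\<forall>k\<in>I. (R(i := a)) k \<in> S k" using R(2) a by auto
      ultimately show ?thesis by blast
    qed simp
  qed
qed

text \<open>Each parent that no leaf of \<open>J\<close> uses still has a leaf in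
  \<open>L - J\<close>. In Hall's condition this makes the demand at few parents small.\<close>

lemma card_subset_demand:
  assumes "finite L" "J \<subseteq> L"
  shows "card J + card (q ` L) \<le> card L + card (q ` J)"
proof -
  have "card (q ` L) \<le> card (q ` J \<union> q ` (L - J))"
    using assms by (intro card_mono) (auto intro: finite_subset)
  moreover have "\<dots> \<le> card (q ` J) + card (q ` (L - J))" by (rule card_Un_le)
  moreover have "card (q ` (L - J)) \<le> card (L - J)" using assms by (intro card_image_le) auto
  moreover have "card (L - J) + card J = card L"
    using assms by (metis card_Diff_subset card_mono finite_subset le_add_diff_inverse2)
  ultimately show ?thesis by linarith
qed

text \<open>The median property for the interval before \<open>u\<close>, minus the images there,
  gives the free in-neighbours. The other bounds locate \<open>u\<close> within the block; they rest
  on \<open>u\<close> being the leftmost point of \<open>A\<close>.\<close>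

lemma free_in_neighbours:
  fixes X :: "nat set"
  assumes med: "median_order Q N" and X: "X \<subseteq> {l..<h}" and A: "A \<subseteq> X" "A \<noteq> {}" "\<And>x. x \<in> A \<Longrightarrow> x < N"
  defines "u \<equiv> Min A"
  shows "u \<in> A" "u \<le> 2 * card {t. t < u \<and> t \<notin> X \<and> Q t u} + 2 * card (X \<inter> {..<u})"
    "card (X \<inter> {..<u}) + card A \<le> card X" "l + card (X \<inter> {..<u}) \<le> u" "card A + u \<le> h"
proof -
  have finX: "finite X" using X finite_subset by blast
  have finA: "finite A" using A finX finite_subset by blast
  show u: "u \<in> A" unfolding u_def using finA A by (intro Min_in)
  have ge: "u \<le> x" if "x \<in> A" for x unfolding u_def using finA that by (intro Min_le)
  let ?I = "{t. t < u \<and> t \<notin> X \<and> Q t u}"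
  have "0 \<le> u \<and> u < N \<longrightarrow> u - 0 \<le> 2 * card {t \<in> {0..<u}. Q t u}"
    using med unfolding median_order_def by blast
  then have "u \<le> 2 * card {t \<in> {0..<u}. Q t u}" using A(3)[OF u] by simp
  also have "card {t \<in> {0..<u}. Q t u} \<le> card (?I \<union> (X \<inter> {..<u}))"
    using finX by (intro card_mono) auto
  also have "\<dots> \<le> card ?I + card (X \<inter> {..<u})" by (rule card_Un_le)
  finally show "u \<le> 2 * card ?I + 2 * card (X \<inter> {..<u})" by simp
  have "card (X \<inter> {..<u}) + card A = card ((X \<inter> {..<u}) \<union> A)"
    using finX finA ge by (intro card_Un_disjoint[symmetric]) fastforce+
  also have "\<dots> \<le> card X" using finX A(1) by (intro card_mono) auto
  finally show "card (X \<inter> {..<u}) + card A \<le> card X" .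
  have "card (X \<inter> {..<u}) \<le> card {l..<u}" using X by (intro card_mono) auto
  moreover have lu: "l \<le> u" "u < h" using u A(1) X by auto
  ultimately show "l + card (X \<inter> {..<u}) \<le> u" by simp
  have "card A \<le> card {u..<h}" using X A(1) ge by (intro card_mono) auto
  then show "card A + u \<le> h" using lu by simp
qed

text \<open>The mirror image of \<open>free_in_neighbours\<close>, with the room
  \<open>N - h\<close> to the right of the block in place of \<open>l\<close>.\<close>

lemma free_out_neighbours_block:
  fixes X :: "nat set"
  assumes med: "median_order Q N" and X: "X \<subseteq> {l..<h}" and h: "h \<le> N" and A: "A \<subseteq> X" "A \<noteq> {}"
  defines "w \<equiv> Max A"
  shows "w \<in> A" "N - Suc w \<le> 2 * card {t. w < t \<and> t < N \<and> t \<notin> X \<and> Q w t} + 2 * card (X \<inter> {w<..})"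
    "card (X \<inter> {w<..}) + card A \<le> card X" "N - h + card (X \<inter> {w<..}) \<le> N - Suc w"
    "card A + l \<le> Suc w"
proof -
  have finX: "finite X" using X finite_subset by blast
  have finA: "finite A" using A finX finite_subset by blast
  show w: "w \<in> A" unfolding w_def using finA A by (intro Max_in)
  have ge: "x \<le> w" if "x \<in> A" for x unfolding w_def using finA that by (intro Max_ge)
  have lw: "l \<le> w" "w < h" using w A(1) X by auto
  let ?I = "{t. w < t \<and> t < N \<and> t \<notin> X \<and> Q w t}"
  have "w < N \<and> N \<le> N \<longrightarrow> N - Suc w \<le> 2 * card {t \<in> {w<..<N}. Q w t}"
    using med unfolding median_order_def by blast
  then have "N - Suc w \<le> 2 * card {t \<in> {w<..<N}. Q w t}" using lw h by simp
  also have "card {t \<in> {w<..<N}. Q w t} \<le> card (?I \<union> (X \<inter> {w<..}))"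
    using finX by (intro card_mono) auto
  also have "\<dots> \<le> card ?I + card (X \<inter> {w<..})" by (rule card_Un_le)
  finally show "N - Suc w \<le> 2 * card ?I + 2 * card (X \<inter> {w<..})" by simp
  have "card (X \<inter> {w<..}) + card A = card ((X \<inter> {w<..}) \<union> A)"
    using finX finA ge by (intro card_Un_disjoint[symmetric]) fastforce+
  also have "\<dots> \<le> card X" using finX A(1) by (intro card_mono) auto
  finally show "card (X \<inter> {w<..}) + card A \<le> card X" .
  have "card (X \<inter> {w<..}) \<le> card {w<..<h}" using X by (intro card_mono) auto
  then show "N - h + card (X \<inter> {w<..}) \<le> N - Suc w" using lw h by simp
  have "card A \<le> card {l..w}" using X A(1) ge by (intro card_mono) fastforce+
  then show "card A + l \<le> Suc w" using lw by simp
qed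

text \<open>
  Hall's condition is verified with the in-neighbours of the leftmost of the images that need
  in-leaves and the out-neighbours of the rightmost of the images that need out-leaves. These
  sets can overlap only if all of the latter images lie to the left of all of the former.
\<close>

lemma attach_leaves:
  fixes X :: "nat set" and q :: "'l \<Rightarrow> nat"
  assumes med: "median_order Q N" and X: "X \<subseteq> {l..<l + B}" and N: "N = l + B + r"
    and fin: "finite Li" "finite Lo" and disj: "Li \<inter> Lo = {}" and q: "q ` (Li \<union> Lo) \<subseteq> X"
    and hin: "2 * card Li + card X \<le> l + card (q ` Li) + 1"
    and hout: "2 * card Lo + card X \<le> r + card (q ` Lo) + 1"
    and hboth: "card X = 1 \<or>
      2 * card Li + 2 * card Lo + 2 * card X \<le> l + r + card (q ` Li) + card (q ` Lo)"
  obtains g where "inj_on g (Li \<union> Lo)" "g ` (Li \<union> Lo) \<subseteq> {..<N} - X"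
    "\<And>x. x \<in> Li \<Longrightarrow> Q (g x) (q x)" "\<And>x. x \<in> Lo \<Longrightarrow> Q (q x) (g x)"
proof -
  have finX: "finite X" using X finite_subset by blast
  define S where "S = (\<lambda>x. {t. t < N \<and> t \<notin> X \<and> (if x \<in> Li then Q t (q x) else Q (q x) t)})"
  have "\<exists>R. inj_on R (Li \<union> Lo) \<and> (\<forall>x\<in>Li \<union> Lo. R x \<in> S x)"
  proof (rule Hall_marriage)
    fix J assume J: "J \<subseteq> Li \<union> Lo"
    define J1 where "J1 = J \<inter> Li"
    define J2 where "J2 = J \<inter> Lo"
    define C where "C = q ` J1"
    define D where "D = q ` J2"
    define u where "u = Min C"
    define w where "w = Max D"
    define In where "In = {t. t < u \<and> t \<notin> X \<and> Q t u}"
    define Out where "Out = {t. w < t \<and> t < N \<and> t \<notin> X \<and> Q w t}"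
    have J12: "J = J1 \<union> J2" "J1 \<subseteq> Li" "J2 \<subseteq> Lo" using J unfolding J1_def J2_def by auto
    have finJ: "finite J1" "finite J2" using J12 fin finite_subset by auto
    have cJ: "card J = card J1 + card J2"
      unfolding J12(1) using finJ J12 disj by (intro card_Un_disjoint) auto
    have CX: "C \<subseteq> X" "D \<subseteq> X" using q J12 unfolding C_def D_def by auto
    have dem: "card J1 + card (q ` Li) \<le> card Li + card C" "card J2 + card (q ` Lo) \<le> card Lo + card D"
      unfolding C_def D_def using card_subset_demand fin J12 by blast+
    have le: "card C \<le> card (q ` Li)" "card D \<le> card (q ` Lo)"
      unfolding C_def D_def using fin J12 by (auto intro!: card_mono)
    have lt: "x < N" if "x \<in> X" for x using that X N by auto
    have US: "finite (\<Union> (S ` J))" by (rule finite_subset[of _ "{..<N}"]) (auto simp: S_def)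
    have I: "In \<subseteq> \<Union> (S ` J)" "u \<in> C" "u \<le> 2 * card In + 2 * card (X \<inter> {..<u})"
      "card (X \<inter> {..<u}) + card C \<le> card X" "l + card (X \<inter> {..<u}) \<le> u" "card C + u \<le> l + B"
      "card J1 \<le> card In" if "J1 \<noteq> {}"
    proof -
      have C: "C \<noteq> {}" "\<And>x. x \<in> C \<Longrightarrow> x < N" using that CX lt unfolding C_def by auto
      note * = free_in_neighbours[OF med X CX(1) C, folded u_def, folded In_def]
      show **: "u \<in> C" "u \<le> 2 * card In + 2 * card (X \<inter> {..<u})"
        "card (X \<inter> {..<u}) + card C \<le> card X" "l + card (X \<inter> {..<u}) \<le> u" "card C + u \<le> l + B"
        using * by blast+
      obtain x where x: "x \<in> J1" "u = q x" using **(1) unfolding C_def by blast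
      have "u < N" using C(2) **(1) by blast
      then have "In \<subseteq> S x" using x J12 unfolding S_def In_def by auto
      then show "In \<subseteq> \<Union> (S ` J)" using x J12 by blast
      \<comment> \<open>Twice the supply is at least \<open>l - card X + card C\<close>, and twice
        the demand is at most one more than that; parity closes the gap.\<close>
      show "card J1 \<le> card In" using **(2,3,4) dem(1) le(1) hin by linarith
    qed
    have O: "Out \<subseteq> \<Union> (S ` J)" "w \<in> D" "N - Suc w \<le> 2 * card Out + 2 * card (X \<inter> {w<..})"
      "card (X \<inter> {w<..}) + card D \<le> card X" "r + card (X \<inter> {w<..}) \<le> N - Suc w"
      "card D + l \<le> Suc w" "card J2 \<le> card Out" if "J2 \<noteq> {}"
    proof -
      have D: "D \<noteq> {}" using that unfolding D_def by auto
      have hN: "l + B \<le> N" "N - (l + B) = r" using N by auto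
      note * = free_out_neighbours_block[OF med X hN(1) CX(2) D, folded w_def, folded Out_def, unfolded hN(2)]
      show **: "w \<in> D" "N - Suc w \<le> 2 * card Out + 2 * card (X \<inter> {w<..})"
        "card (X \<inter> {w<..}) + card D \<le> card X" "r + card (X \<inter> {w<..}) \<le> N - Suc w"
        "card D + l \<le> Suc w" using * by blast+
      obtain x where x: "x \<in> J2" "w = q x" using **(1) unfolding D_def by blast
      have "x \<notin> Li" using x J12 disj by blast
      then have "Out \<subseteq> S x" using x unfolding S_def Out_def by auto
      then show "Out \<subseteq> \<Union> (S ` J)" using x J12 by blast
      show "card J2 \<le> card Out" using **(2,3,4) dem(2) le(2) hout by linarith
    qed
    consider "J1 = {}" "J2 = {}" | "J1 = {}" "J2 \<noteq> {}" | "J1 \<noteq> {}" "J2 = {}"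
      | "J1 \<noteq> {}" "J2 \<noteq> {}" "u \<le> Suc w" | "J1 \<noteq> {}" "J2 \<noteq> {}" "Suc w < u" by linarith
    then show "card J \<le> card (\<Union> (S ` J))"
    proof cases
      case 1
      then show ?thesis using cJ by simp
    next
      case 2
      then show ?thesis using cJ O(1,7) card_mono[OF US, of Out] by simp
    next
      case 3
      then show ?thesis using cJ I(1,7) card_mono[OF US, of In] by simp
    next
      case 4
      have finIO: "finite In" "finite Out" using US I(1) O(1) 4 finite_subset by blast+
      have "card J \<le> card In + card Out" using cJ I(7) O(7) 4 by linarith
      also have "\<dots> = card (In \<union> Out)"
        using finIO 4 by (intro card_Un_disjoint[symmetric]) (auto simp: In_def Out_def)
      also have "\<dots> \<le> card (\<Union> (S ` J))" using US I(1) O(1) 4 by (intro card_mono) auto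
      finally show ?thesis .
    next
      case 5
      note I = I[OF 5(1)] and O = O[OF 5(2)]
      have finIO: "finite In" "finite Out" using US I(1) O(1) finite_subset by blast+
      have finCD: "finite C" "finite D" using finJ unfolding C_def D_def by auto
      let ?p = "card (X \<inter> {w<..<u})"
      \<comment> \<open>\<open>In\<close> and \<open>Out\<close> meet only strictly between
        \<open>w\<close> and \<open>u\<close>, off the \<open>?p\<close> images there. The same
        images are counted twice when those left of \<open>u\<close> and those right of
        \<open>w\<close> are added, so \<open>?p\<close> cancels.\<close>
      have "card In + card Out = card (In \<union> Out) + card (In \<inter> Out)"
        using finIO by (rule card_Un_Int)
      moreover have "card (In \<inter> Out) + ?p \<le> u - Suc w"
      proof -
        have "card (In \<inter> Out) + ?p = card ((In \<inter> Out) \<union> (X \<inter> {w<..<u}))"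
          using finIO by (intro card_Un_disjoint[symmetric]) (auto simp: In_def)
        also have "\<dots> \<le> card {w<..<u}" by (intro card_mono) (auto simp: In_def Out_def)
        finally show ?thesis by simp
      qed
      moreover have "card (X \<inter> {..<u}) + card (X \<inter> {w<..}) = card X + ?p"
      proof -
        have "(X \<inter> {..<u}) \<union> (X \<inter> {w<..}) = X" "(X \<inter> {..<u}) \<inter> (X \<inter> {w<..}) = X \<inter> {w<..<u}"
          using 5(3) by auto
        then show ?thesis using card_Un_Int[of "X \<inter> {..<u}" "X \<inter> {w<..}"] finX by simp
      qed
      moreover have "card (In \<union> Out) \<le> card (\<Union> (S ` J))" using US I(1) O(1) by (intro card_mono) auto
      \<comment> \<open>With a single image this is impossible, as \<open>C\<close> and
        \<open>D\<close> are both nonempty; hence the first alternative of \<open>hboth\<close>.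
        Otherwise \<open>u - w \<le> B + 1 - card C - card D\<close>, and the second alternative
        covers the demand.\<close>
      moreover have "card C + card D \<le> card X"
      proof -
        have "x \<notin> D" if "x \<in> C" for x
        proof
          assume "x \<in> D"
          then have "x \<le> w" "u \<le> x" unfolding w_def u_def using finCD that by auto
          then show False using 5(3) by simp
        qed
        then have "card C + card D = card (C \<union> D)"
          using finCD by (intro card_Un_disjoint[symmetric]) auto
        also have "\<dots> \<le> card X" using finX CX by (intro card_mono) auto
        finally show ?thesis .
      qed
      moreover have "0 < card C" "0 < card D" using I(2) O(2) finCD card_gt_0_iff by blast+
      moreover have "w < N" using lt O(2) CX by blast
      ultimately show ?thesis
        using cJ dem le hboth I(3,6) O(3,6) 5(3) N by linarith
    qed
  next
    show "finite (Li \<union> Lo)" using fin by simp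
    show "finite (S x)" for x unfolding S_def by (rule finite_subset[of _ "{..<N}"]) auto
  qed
  then obtain R where R: "inj_on R (Li \<union> Lo)" "\<And>x. x \<in> Li \<union> Lo \<Longrightarrow> R x \<in> S x" by blast
  show ?thesis
  proof (rule that[OF R(1)])
    show "R ` (Li \<union> Lo) \<subseteq> {..<N} - X" using R(2) unfolding S_def by auto
    show "Q (R x) (q x)" if "x \<in> Li" for x using R(2)[of x] that unfolding S_def by auto
    show "Q (q x) (R x)" if "x \<in> Lo" for x using R(2)[of x] that disj unfolding S_def by (auto split: if_splits)
  qed
qed

text \<open>
  The inner tree goes into a block of \<open>B\<close> consecutive vertices of a median order; \<open>l\<close> is the least
  number of vertices to its left that leaves room for the in-leaves.
\<close>

lemma tree_with_leaves_in_tournament: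
  fixes Li Lo :: "nat set"
  assumes t: "rooted_tree A r p" and fin: "finite Li" "finite Lo" and disj: "Li \<inter> Lo = {}"
    and AL: "A \<inter> (Li \<union> Lo) = {}" and q: "q ` (Li \<union> Lo) \<subseteq> A"
    and pendant: "insert r (childless A r p) \<subseteq> q ` (Li \<union> Lo)"
    and V: "finite V" "tournament_on T V"
    and big: "2 * card Li + 2 * card Lo \<le> card V"
      "A = {r} \<or> 4 * card A + 2 * card Li + 2 * card Lo \<le> card V + 3"
  obtains f where "oriented_embedding A r p up T V f" "inj_on f (A \<union> Li \<union> Lo)" "f ` (A \<union> Li \<union> Lo) \<subseteq> V"
    "\<forall>x\<in>Li. T (f x) (f (q x))" "\<forall>x\<in>Lo. T (f (q x)) (f x)"
proof -
  let ?L = "childless A r p"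
  have finA: "finite A" and rA: "r \<in> A" using t by (auto simp: rooted_tree_def)
  have finL: "finite ?L" using finA by (simp add: childless_def)
  define d where "d = card A - 1"
  have cA: "card A = d + 1" using finA rA card_gt_0_iff[of A] unfolding d_def by force
  \<comment> \<open>The order that \<open>oriented_tree_in_tournament\<close> asks for with
    \<open>d + 1\<close> nodes; \<open>l\<close> turns the condition \<open>hin\<close> of
    \<open>attach_leaves\<close> into an equality.\<close>
  define B where "B = 2 * d + card ?L"
  define l where "l = 2 * card Li + d - card (q ` Li)"
  have ai: "card (q ` Li) \<le> card Li" "card (q ` Lo) \<le> card Lo" using fin by (auto intro: card_image_le)
  have l: "l + card (q ` Li) = 2 * card Li + d" using ai unfolding l_def by linarith
  have sup: "card (insert r ?L) \<le> card (q ` Li) + card (q ` Lo)"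
  proof -
    have "card (insert r ?L) \<le> card (q ` Li \<union> q ` Lo)"
      using pendant fin by (intro card_mono) auto
    also have "\<dots> \<le> card (q ` Li) + card (q ` Lo)" by (rule card_Un_le)
    finally show ?thesis .
  qed
  define N where "N = card V"
  have "l + B \<le> N \<and> 2 * card Lo + (d + 1) \<le> N - (l + B) + card (q ` Lo) + 1
    \<and> (d + 1 = 1 \<or> 2 * card Li + 2 * card Lo + 2 * (d + 1)
          \<le> l + (N - (l + B)) + card (q ` Li) + card (q ` Lo))"
  proof (cases "A = {r}")
    case True
    \<comment> \<open>A single root is itself childless, so only one parent of leaves is guaranteed,
      not \<open>card ?L + 1\<close>. Here the condition on both kinds of leaves holds because there
      is just one image.\<close>
    then have "?L = {r}" by (auto simp: childless_def)
    then have "card ?L = 1" "card (insert r ?L) = 1" by simp_all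
    moreover have "d = 0" using True unfolding d_def by simp
    ultimately show ?thesis using big(1) sup l ai unfolding B_def N_def by auto
  next
    case False
    then obtain z where "z \<in> A - {r}" "z \<notin> {r}" "p z \<in> {r}"
      using missing_child[OF t, of "{r}"] rA by auto
    then have "r \<notin> ?L" by (auto simp: childless_def)
    then have "card (insert r ?L) = card ?L + 1" using finL by simp
    then have "card ?L + 1 \<le> card (q ` Li) + card (q ` Lo)" using sup by simp
    \<comment> \<open>With \<open>card ?L + 1\<close> parents of leaves, the third inequality asks
      for \<open>B + 2 * d + 2 * card Li + 2 * card Lo + 2 - (card ?L + 1)\<close> vertices, which
      is exactly this number.\<close>
    moreover have "4 * d + 2 * card Li + 2 * card Lo + 1 \<le> N" using big(2) False cA unfolding N_def by simp
    moreover from calculation have "l + B \<le> N" using l ai unfolding B_def by linarith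
    ultimately show ?thesis using l unfolding B_def by auto
  qed
  then have lB: "l + B \<le> N" and hout: "2 * card Lo + (d + 1) \<le> N - (l + B) + card (q ` Lo) + 1"
    and hboth: "d + 1 = 1 \<or> 2 * card Li + 2 * card Lo + 2 * (d + 1)
          \<le> l + (N - (l + B)) + card (q ` Li) + card (q ` Lo)" by auto
  obtain e where e: "bij_betw e {..<N} V" and med: "median_order (\<lambda>i j. T (e i) (e j)) N"
    using median_order_exists[OF V] unfolding N_def by blast
  let ?Q = "\<lambda>i j. T (e i) (e j)"
  have "tournament_on ?Q {..<N}" using med unfolding median_order_def by blast
  then have tn: "tournament_on ?Q {l..<l + B}" by (rule tournament_on_subset) (use lB in auto)
  have "2 * card A + card ?L \<le> card {l..<l + B} + 2" using cA unfolding B_def by simp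
  then obtain f0 where f0: "oriented_embedding A r p up ?Q {l..<l + B} f0"
    using oriented_tree_in_tournament[OF t finite_atLeastLessThan tn] by blast
  define X where "X = f0 ` A"
  have inj0: "inj_on f0 A" and X: "X \<subseteq> {l..<l + B}"
    using f0 unfolding oriented_embedding_def X_def by auto
  have cX: "card X = d + 1" unfolding X_def using card_image[OF inj0] cA by simp
  have im: "card ((f0 \<circ> q) ` Li) = card (q ` Li)" "card ((f0 \<circ> q) ` Lo) = card (q ` Lo)"
    using q inj0 unfolding image_comp[symmetric]
    by (auto intro!: card_image[OF inj_on_subset[OF inj0]])
  have qX: "(f0 \<circ> q) ` (Li \<union> Lo) \<subseteq> X" using q unfolding X_def by auto
  have NN: "N = l + B + (N - (l + B))" using lB by simp
  have hin: "2 * card Li + card X \<le> l + card ((f0 \<circ> q) ` Li) + 1" using l cX im by simp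
  have hout': "2 * card Lo + card X \<le> N - (l + B) + card ((f0 \<circ> q) ` Lo) + 1" using hout cX im by simp
  have hboth': "card X = 1 \<or> 2 * card Li + 2 * card Lo + 2 * card X
      \<le> l + (N - (l + B)) + card ((f0 \<circ> q) ` Li) + card ((f0 \<circ> q) ` Lo)"
    using hboth unfolding cX im .
  obtain g where g: "inj_on g (Li \<union> Lo)" "g ` (Li \<union> Lo) \<subseteq> {..<N} - X"
    "\<And>x. x \<in> Li \<Longrightarrow> ?Q (g x) ((f0 \<circ> q) x)" "\<And>x. x \<in> Lo \<Longrightarrow> ?Q ((f0 \<circ> q) x) (g x)"
    using attach_leaves[OF med X NN fin disj qX hin hout' hboth'] by blast
  define f where "f = (\<lambda>x. if x \<in> A then f0 x else g x)"
  have fA: "f x = f0 x" if "x \<in> A" for x using that unfolding f_def by simp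
  have fL: "f x = g x" if "x \<in> Li \<union> Lo" for x using that AL unfolding f_def by auto
  have par: "p x \<in> A" if "x \<in> A - {r}" for x using t that unfolding rooted_tree_def by blast
  have qA: "q x \<in> A" if "x \<in> Li \<union> Lo" for x using that q by blast
  have img: "f ` (A \<union> Li \<union> Lo) \<subseteq> {..<N}"
    using fA fL g(2) X lB unfolding X_def by fastforce
  have inj: "inj_on f (A \<union> (Li \<union> Lo))"
  proof (rule iffD2[OF inj_on_Un], intro conjI)
    show "inj_on f A" using inj0 inj_on_cong[of A f f0] fA by blast
    show "inj_on f (Li \<union> Lo)" using g(1) inj_on_cong[of "Li \<union> Lo" f g] fL by blast
    have "f ` A = X" "f ` (Li \<union> Lo) = g ` (Li \<union> Lo)" using fA fL unfolding X_def by (auto simp: image_def)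
    then show "f ` (A - (Li \<union> Lo)) \<inter> f ` (Li \<union> Lo - A) = {}" using g(2) by blast
  qed
  have emb: "oriented_embedding A r p up ?Q {..<N} f"
    unfolding oriented_embedding_def
  proof (intro conjI ballI)
    show "inj_on f A" using inj by (rule inj_on_subset) auto
    show "f ` A \<subseteq> {..<N}" using img by blast
    fix x assume "x \<in> A - {r}"
    then show "if x \<in> up then ?Q (f x) (f (p x)) else ?Q (f (p x)) (f x)"
      using f0 fA par unfolding oriented_embedding_def by auto
  qed
  have einj: "inj_on e {..<N}" and eV: "e ` {..<N} = V" using e by (auto simp: bij_betw_def)
  have inj2: "inj_on (e \<circ> f) (A \<union> Li \<union> Lo)"
    using inj img einj by (intro comp_inj_on) (auto simp: Un_assoc elim: inj_on_subset)
  have img2: "(e \<circ> f) ` (A \<union> Li \<union> Lo) \<subseteq> V" using img eV by (auto simp: image_comp[symmetric])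
  show ?thesis
  proof (rule that[of "e \<circ> f"])
    show "oriented_embedding A r p up T V (e \<circ> f)"
      using emb inj2 img2 unfolding oriented_embedding_def
      by (auto elim: inj_on_subset)
    show "\<forall>x\<in>Li. T ((e \<circ> f) x) ((e \<circ> f) (q x))"
    proof
      fix x assume x: "x \<in> Li"
      show "T ((e \<circ> f) x) ((e \<circ> f) (q x))" using g(3)[OF x] fL[of x] fA[OF qA[of x]] x by simp
    qed
    show "\<forall>x\<in>Lo. T ((e \<circ> f) (q x)) ((e \<circ> f) x)"
    proof
      fix x assume x: "x \<in> Lo"
      show "T ((e \<circ> f) (q x)) ((e \<circ> f) x)" using g(4)[OF x] fL[of x] fA[OF qA[of x]] x by simp
    qed
  qed (fact inj2 img2)+
qed

section \<open>Numbering the vertices of a tree\<close>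

text \<open>Simple paths within the numbered set are part of the induction: two earlier neighbours
  of a new vertex, joined by such a path, would close a cycle with it. Hence the parent is the only
  earlier neighbour. Connectivity enters as a crossing edge for every proper set that contains the
  root.\<close>

lemma tree_numbering_prefix:
  assumes "finite V" "r \<in> V"
    and E: "\<forall>x y. E x y \<longrightarrow> E y x \<and> x \<in> V \<and> y \<in> V"
    and conn: "\<forall>S. r \<in> S \<and> S \<subset> V \<longrightarrow> (\<exists>x\<in>S. \<exists>y\<in>V - S. E x y)"
    and acyc: "\<nexists>z xs. distinct (z # xs) \<and> 2 \<le> length xs \<and> successively E xs \<and>
      E z (hd xs) \<and> E (last xs) z"
    and "Suc m \<le> card V"
  shows "\<exists>g p. inj_on g {..m} \<and> g ` {..m} \<subseteq> V \<and> g 0 = r \<and>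
    (\<forall>x\<in>{0<..m}. p x < x \<and> E (g (p x)) (g x) \<and> (\<forall>y<x. E (g y) (g x) \<longrightarrow> y = p x)) \<and>
    (\<forall>u\<in>g ` {..m}. \<forall>v\<in>g ` {..m}. \<exists>xs. xs \<noteq> [] \<and> hd xs = u \<and> last xs = v \<and>
       distinct xs \<and> set xs \<subseteq> g ` {..m} \<and> successively E xs)"
  using assms(6)
proof (induction m)
  case 0
  show ?case using assms(2) by (intro exI[of _ "\<lambda>_. r"] exI[of _ "\<lambda>_. 0"]) (auto intro: exI[of _ "[r]"])
next
  case (Suc m)
  obtain g p where gp: "inj_on g {..m} \<and> g ` {..m} \<subseteq> V \<and> g 0 = r \<and>
    (\<forall>x\<in>{0<..m}. p x < x \<and> E (g (p x)) (g x) \<and> (\<forall>y<x. E (g y) (g x) \<longrightarrow> y = p x)) \<and>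
    (\<forall>u\<in>g ` {..m}. \<forall>v\<in>g ` {..m}. \<exists>xs. xs \<noteq> [] \<and> hd xs = u \<and> last xs = v \<and>
       distinct xs \<and> set xs \<subseteq> g ` {..m} \<and> successively E xs)"
    using Suc.IH[OF Suc_leD[OF Suc.prems]] by (elim exE) (rule that)
  note inj = gp[THEN conjunct1] and gV = gp[THEN conjunct2, THEN conjunct1]
    and g0 = gp[THEN conjunct2, THEN conjunct2, THEN conjunct1]
    and par = bspec[OF gp[THEN conjunct2, THEN conjunct2, THEN conjunct2, THEN conjunct1]]
    and path = bspec[OF bspec[OF gp[THEN conjunct2, THEN conjunct2, THEN conjunct2, THEN conjunct2]]]
  let ?S = "g ` {..m}"
  have "card ?S = Suc m" using inj by (simp add: card_image)
  then have "?S \<subset> V" using gV Suc.prems by auto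
  moreover have "r \<in> ?S" using g0 by auto
  ultimately have "\<exists>x\<in>?S. \<exists>y\<in>V - ?S. E x y"
    by (intro conn[THEN spec, THEN mp] conjI)
  then obtain a z where "a \<in> ?S" and z: "z \<in> V - ?S" and "E a z" by (elim bexE) (rule that)
  then obtain i where i: "i \<le> m" "E (g i) z" by auto
  have zS: "z \<notin> ?S" using z by simp
  have uniq: "y = i" if y: "y \<le> m" "E (g y) z" for y
  proof (rule ccontr)
    assume "y \<noteq> i"
    then have ne: "g y \<noteq> g i" using inj y(1) i(1) by (auto simp: inj_on_def)
    obtain xs where xs: "xs \<noteq> []" "hd xs = g y" "last xs = g i" "distinct xs" "set xs \<subseteq> ?S"
      "successively E xs" using path[of "g y" "g i"] y i by blast
    have "2 \<le> length xs" using xs(1-3) ne by (cases xs; cases "tl xs") auto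
    moreover have "distinct (z # xs)" using xs zS by auto
    moreover have "E z (hd xs)" "E (last xs) z" using xs(2,3) E i(2) y(2) by auto
    ultimately show False using acyc xs(6) by blast
  qed
  define g' where "g' = g(Suc m := z)"
  define p' where "p' = p(Suc m := i)"
  have old: "g' x = g x" if "x \<le> m" for x using that unfolding g'_def by simp
  have img: "g' ` {..m} = ?S" using old by auto
  have new: "g' (Suc m) = z" unfolding g'_def by simp
  have imgS: "g' ` {..Suc m} = insert z ?S" unfolding atMost_Suc image_insert img new ..
  have "inj_on g' {..Suc m}"
    unfolding atMost_Suc inj_on_insert
  proof
    show "inj_on g' {..m}" using inj inj_on_cong[of "{..m}" g' g] old by simp
    show "g' (Suc m) \<notin> g' ` ({..m} - {Suc m})" using img new zS by auto
  qed
  moreover have "g' ` {..Suc m} \<subseteq> V" unfolding imgS using gV z by auto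
  moreover have "g' 0 = r" using g0 by (simp add: g'_def)
  moreover have par': "p' x < x \<and> E (g' (p' x)) (g' x) \<and> (\<forall>y<x. E (g' y) (g' x) \<longrightarrow> y = p' x)"
    if x: "x \<in> {0<..Suc m}" for x
  proof (cases "x = Suc m")
    case True
    have "\<forall>y<x. E (g' y) (g' x) \<longrightarrow> y = i"
    proof (intro allI impI)
      fix y assume y: "y < x" "E (g' y) (g' x)"
      then have "y \<le> m" using True by simp
      moreover have "E (g y) z" using y(2) unfolding True new old[OF \<open>y \<le> m\<close>] .
      ultimately show "y = i" by (rule uniq)
    qed
    moreover have "p' x = i" "g' x = z" "g' i = g i" using True new i old unfolding p'_def by auto
    ultimately show ?thesis using i True by simp
  next
    case False
    then have xm: "x \<in> {0<..m}" using x by auto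
    note px = par[OF xm]
    have "p x \<le> m" "x \<le> m" "p' x = p x" using px xm by (auto simp: p'_def)
    moreover have "g' y = g y" if "y < x" for y using that xm by (intro old) simp
    ultimately show ?thesis using px by (simp add: old)
  qed
  moreover have path': "\<exists>xs. xs \<noteq> [] \<and> hd xs = u \<and> last xs = v \<and>
       distinct xs \<and> set xs \<subseteq> insert z ?S \<and> successively E xs"
    if uv: "u \<in> insert z ?S" "v \<in> insert z ?S" for u v
  proof -
    consider "u = z" "v = z" | "u = z" "v \<in> ?S" | "u \<in> ?S" "v = z" | "u \<in> ?S" "v \<in> ?S"
      using uv by blast
    then show ?thesis
    proof cases
      case 1
      then show ?thesis by (intro exI[of _ "[z]"]) auto
    next
      case 2
      then obtain xs where "xs \<noteq> []" "hd xs = g i" "last xs = v" "distinct xs" "set xs \<subseteq> ?S"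
        "successively E xs" using path[of "g i" v] i by blast
      then show ?thesis using 2 i E zS
        by (intro exI[of _ "z # xs"]) (auto simp: successively_Cons)
    next
      case 3
      then obtain xs where "xs \<noteq> []" "hd xs = u" "last xs = g i" "distinct xs" "set xs \<subseteq> ?S"
        "successively E xs" using path[of u "g i"] i by blast
      then show ?thesis using 3 i E zS
        by (intro exI[of _ "xs @ [z]"]) (auto simp: successively_append_iff)
    next
      case 4
      then obtain xs where "xs \<noteq> []" "hd xs = u" "last xs = v" "distinct xs" "set xs \<subseteq> ?S"
        "successively E xs" using path[of u v] by blast
      then show ?thesis by (intro exI[of _ xs]) auto
    qed
  qed
  ultimately show ?case
    using ballI[OF par'] ballI[OF ballI[OF path']]
    unfolding imgS[symmetric] by (intro exI[of _ g'] exI[of _ p'] conjI) assumption+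
qed

lemma tree_numbering:
  assumes "finite V" "r \<in> V"
    and E: "\<forall>x y. E x y \<longrightarrow> E y x \<and> x \<in> V \<and> y \<in> V" "\<forall>x. \<not> E x x"
    and conn: "\<forall>S. r \<in> S \<and> S \<subset> V \<longrightarrow> (\<exists>x\<in>S. \<exists>y\<in>V - S. E x y)"
    and acyc: "\<nexists>z xs. distinct (z # xs) \<and> 2 \<le> length xs \<and> successively E xs \<and>
      E z (hd xs) \<and> E (last xs) z"
  obtains g p where "bij_betw g {..<card V} V" "g 0 = r"
    "\<And>x. x < card V \<Longrightarrow> 0 < x \<Longrightarrow> p x < x"
    "\<And>x y. x < card V \<Longrightarrow> y < card V \<Longrightarrow> E (g x) (g y) \<longleftrightarrow> 0 < y \<and> p y = x \<or> 0 < x \<and> p x = y"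
proof -
  have "0 < card V" using assms(1,2) card_gt_0_iff by blast
  then obtain m where m: "card V = Suc m" using gr0_implies_Suc by blast
  then have le: "Suc m \<le> card V" by simp
  obtain g p where gp: "inj_on g {..m} \<and> g ` {..m} \<subseteq> V \<and> g 0 = r \<and>
    (\<forall>x\<in>{0<..m}. p x < x \<and> E (g (p x)) (g x) \<and> (\<forall>y<x. E (g y) (g x) \<longrightarrow> y = p x)) \<and>
    (\<forall>u\<in>g ` {..m}. \<forall>v\<in>g ` {..m}. \<exists>xs. xs \<noteq> [] \<and> hd xs = u \<and> last xs = v \<and>
       distinct xs \<and> set xs \<subseteq> g ` {..m} \<and> successively E xs)"
    using tree_numbering_prefix[OF assms(1,2) E(1) conn acyc le] by (elim exE) (rule that)
  note inj = gp[THEN conjunct1] and gV = gp[THEN conjunct2, THEN conjunct1]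
    and g0 = gp[THEN conjunct2, THEN conjunct2, THEN conjunct1]
    and par = bspec[OF gp[THEN conjunct2, THEN conjunct2, THEN conjunct2, THEN conjunct1]]
    and path = bspec[OF bspec[OF gp[THEN conjunct2, THEN conjunct2, THEN conjunct2, THEN conjunct2]]]
  have "card (g ` {..m}) = card V" using inj m by (simp add: card_image)
  then have "g ` {..m} = V" using gV assms(1) by (simp add: card_subset_eq)
  then have bij: "bij_betw g {..<card V} V" using inj m by (simp add: bij_betw_def lessThan_Suc_atMost)
  have lt: "E (g x) (g y) \<longleftrightarrow> 0 < y \<and> p y = x" if "x < y" "y \<le> m" for x y
    using par[of y] that by auto
  have "E (g x) (g y) \<longleftrightarrow> 0 < y \<and> p y = x \<or> 0 < x \<and> p x = y" if "x < card V" "y < card V" for x y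
  proof -
    have less: "0 < x \<Longrightarrow> p x < x" "0 < y \<Longrightarrow> p y < y" using par that m by auto
    consider "x < y" | "y < x" | "x = y" by linarith
    then show ?thesis
    proof cases
      case 1
      then show ?thesis using lt[of x y] less that m by auto
    next
      case 2
      moreover have "E (g x) (g y) \<longleftrightarrow> E (g y) (g x)" using E by blast
      ultimately show ?thesis using lt[of y x] less that m by auto
    next
      case 3
      then show ?thesis using E(2) less by auto
    qed
  qed
  then show ?thesis using that[OF bij g0, of p] par m by auto
qed

section \<open>From library trees to the cut and cycle conditions on adjacency\<close>

fun path_arcs :: "'a list \<Rightarrow> ('a \<times> 'a) list" where
  "path_arcs (x # y # zs) = (x, y) # path_arcs (y # zs)"
| "path_arcs _ = []"

lemma path_arcs_walk:
  assumes "successively (\<lambda>x y. (x, y) \<in> A) (x # ys)"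
  shows "set (path_arcs (x # ys)) \<subseteq> A" "pcas x (path_arcs (x # ys)) (last (x # ys))"
    "pawalk_verts x (path_arcs (x # ys)) = x # ys" "length (path_arcs (x # ys)) = length ys"
  using assms by (induction ys arbitrary: x) (auto simp: successively_Cons)

lemma undirected_treeD:
  assumes "undirected_tree G"
  shows "finite (pverts G)" "pverts G \<noteq> {}"
    and "\<forall>x y. (x, y) \<in> parcs G \<longrightarrow> (y, x) \<in> parcs G \<and> x \<in> pverts G \<and> y \<in> pverts G"
    and "\<forall>x. (x, x) \<notin> parcs G"
proof -
  interpret pair_graph G using assms unfolding undirected_tree_def by blast
  show "finite (pverts G)" by (rule pair_finite_verts)
  show "pverts G \<noteq> {}" using assms
    unfolding undirected_tree_def Digraph_Component.connected_def strongly_connected_def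
    by (simp add: mk_symmetric_def)
  show "\<forall>x y. (x, y) \<in> parcs G \<longrightarrow> (y, x) \<in> parcs G \<and> x \<in> pverts G \<and> y \<in> pverts G"
    using pair_sym_arcs in_arcsD1 in_arcsD2 unfolding symmetric_def by (auto dest: symD)
  show "\<forall>x. (x, x) \<notin> parcs G" using pair_no_loops by fastforce
qed

lemma undirected_tree_cut:
  assumes "undirected_tree G" "S \<subset> pverts G" "r \<in> S"
  shows "\<exists>x\<in>S. \<exists>y\<in>pverts G - S. (x, y) \<in> parcs G"
proof (rule ccontr)
  assume no: "\<not> ?thesis"
  obtain v where v: "v \<in> pverts G" "v \<notin> S" using assms(2) by blast
  have sub: "parcs (mk_symmetric (with_proj G)) \<subseteq> parcs G"
    using undirected_treeD(3)[OF assms(1)] unfolding mk_symmetric_def by auto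
  have "reachable (with_proj (mk_symmetric (with_proj G))) r v"
    using assms v
    unfolding undirected_tree_def Digraph_Component.connected_def strongly_connected_def
    by (auto simp: mk_symmetric_def)
  then have "(r, v) \<in> rtrancl_on (pverts G) (parcs (mk_symmetric (with_proj G)))"
    unfolding reachable_def by (simp add: mk_symmetric_def)
  then have "v \<in> S"
  proof (induction rule: rtrancl_on_induct)
    case base
    show ?case by (rule assms(3))
  next
    case (step y z)
    then show ?case using no sub by blast
  qed
  then show False using v by simp
qed

text \<open>The vertex list is closed up at \<open>z\<close> and turned into an arc walk;
  \<open>2 \<le> length xs\<close> is what makes its length at least 3.\<close>

lemma undirected_tree_acyclic:
  assumes "undirected_tree G"
  shows "\<nexists>z xs. distinct (z # xs) \<and> 2 \<le> length xs \<and> successively (\<lambda>x y. (x, y) \<in> parcs G) xs \<and>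
      (z, hd xs) \<in> parcs G \<and> (last xs, z) \<in> parcs G"
proof (intro notI, elim exE conjE)
  fix z xs
  assume xs: "distinct (z # xs)" "2 \<le> length xs" "successively (\<lambda>x y. (x, y) \<in> parcs G) xs"
    "(z, hd xs) \<in> parcs G" "(last xs, z) \<in> parcs G"
  have ne: "xs \<noteq> []" using xs(2) by auto
  let ?ys = "xs @ [z]" and ?p = "path_arcs (z # xs @ [z])"
  have "successively (\<lambda>x y. (x, y) \<in> parcs G) (z # ?ys)"
    using xs(3-5) ne by (simp add: successively_Cons successively_append_iff)
  note p = path_arcs_walk[OF this]
  have "z \<in> pverts G" using undirected_treeD(3)[OF assms] xs(4) by blast
  then have "pre_digraph.awalk (with_proj G) z ?p z"
    using p(1,2) by (simp add: pre_digraph.awalk_def cas_with_proj_eq)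
  moreover have "distinct (tl (pawalk_verts z ?p))" using xs(1) unfolding p(3) by auto
  moreover have len: "3 \<le> length ?p" using xs(2) unfolding p(4) by simp
  then have "?p \<noteq> []" by auto
  ultimately have "pre_digraph.cycle (with_proj G) ?p"
    unfolding pre_digraph.cycle_def awalk_verts_with_proj_eq by blast
  then show False using assms len unfolding undirected_tree_def by blast
qed

text \<open>The tree is numbered twice. The last vertex of a numbering from an arbitrary root has
  its parent as only neighbour, so it is a leaf. The second numbering starts at a neighbour of it,
  which is no leaf because a third vertex must be adjacent to one of the two.\<close>

lemma tree_numbering_from_leaf_neighbour:
  fixes G :: "'a pair_pre_digraph"
  assumes G: "undirected_tree G" and n3: "3 \<le> card (pverts G)"
  defines "V \<equiv> pverts G" and "L \<equiv> {v \<in> pverts G. card {u \<in> pverts G. (u, v) \<in> parcs G} \<le> 1}"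
  obtains g p x0 where "bij_betw g {..<card V} V"
    "\<And>x. x < card V \<Longrightarrow> 0 < x \<Longrightarrow> p x < x"
    "\<And>x y. x < card V \<Longrightarrow> y < card V \<Longrightarrow>
      (g x, g y) \<in> parcs G \<longleftrightarrow> 0 < y \<and> p y = x \<or> 0 < x \<and> p x = y"
    "g 0 \<notin> L" "0 < x0" "x0 < card V" "p x0 = 0" "g x0 \<in> L"
proof -
  let ?E = "\<lambda>x y. (x, y) \<in> parcs G"
  note D = undirected_treeD[OF G, folded V_def]
  note acyc = undirected_tree_acyclic[OF G]
  have cut: "\<forall>S. r \<in> S \<and> S \<subset> V \<longrightarrow> (\<exists>x\<in>S. \<exists>y\<in>V - S. ?E x y)" for r
    using undirected_tree_cut[OF G] unfolding V_def by blast
  have two: "v \<notin> L" if "u \<in> V" "w \<in> V" "u \<noteq> w" "?E u v" "?E w v" for u v w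
  proof
    assume "v \<in> L"
    then have "card {u \<in> V. ?E u v} \<le> 1" unfolding L_def V_def by blast
    moreover have "card {u, w} \<le> card {u \<in> V. ?E u v}" using that D(1) by (intro card_mono) auto
    ultimately show False using that(3) by simp
  qed
  obtain r0 where "r0 \<in> V" using D(2) by blast
  then obtain g1 p1 where g1: "bij_betw g1 {..<card V} V"
    and p1: "\<And>x. x < card V \<Longrightarrow> 0 < x \<Longrightarrow> p1 x < x"
    and adj1: "\<And>x y. x < card V \<Longrightarrow> y < card V \<Longrightarrow>
      ?E (g1 x) (g1 y) \<longleftrightarrow> 0 < y \<and> p1 y = x \<or> 0 < x \<and> p1 x = y"
    using tree_numbering[of V r0 ?E, OF D(1) _ D(3,4) cut acyc] by metis
  define m where "m = card V - 1"
  define u where "u = g1 m"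
  have m: "m < card V" "0 < m" using n3 unfolding m_def V_def by auto
  have uV: "u \<in> V" using g1 m(1) unfolding u_def bij_betw_def by auto
  have uL: "u \<in> L"
  proof -
    have "{w \<in> V. ?E w u} \<subseteq> {g1 (p1 m)}"
    proof
      fix w assume w: "w \<in> {w \<in> V. ?E w u}"
      then obtain x where x: "x < card V" "w = g1 x" using g1 unfolding bij_betw_def by auto
      then have "p1 m = x \<or> 0 < x \<and> p1 x = m" using adj1[of x m] w m unfolding u_def by auto
      moreover have "p1 x \<noteq> m" if "0 < x" using p1[OF x(1) that] x(1) unfolding m_def by simp
      ultimately show "w \<in> {g1 (p1 m)}" using x by blast
    qed
    then have "card {w \<in> V. ?E w u} \<le> card {g1 (p1 m)}" by (intro card_mono) auto
    then show ?thesis using uV unfolding L_def V_def by simp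
  qed
  have "card {u} < card V" using n3 unfolding V_def by simp
  then have "{u} \<subset> V" using uV by auto
  then obtain r where r: "r \<in> V" "r \<noteq> u" "?E u r" using cut[of u] by blast
  have rL: "r \<notin> L"
  proof -
    have "card {u, r} < card V" using n3 r(2) unfolding V_def by simp
    then have "{u, r} \<subset> V" using uV r(1) by auto
    then have "\<exists>x\<in>{u, r}. \<exists>y\<in>V - {u, r}. ?E x y" by (intro cut[THEN spec, THEN mp, of u] conjI) simp_all
    then obtain x y where xy: "x \<in> {u, r}" "y \<in> V - {u, r}" "?E x y" by (elim bexE) (rule that)
    have "x \<noteq> u"
    proof
      assume "x = u"
      then have "?E y u" "?E r u" using xy(3) r(3) D(3) by blast+
      then have "u \<notin> L" using two[of r y u] r(1) xy(2) by blast
      then show False using uL by simp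
    qed
    then have "x = r" using xy(1) by blast
    then have "?E y r" using xy(3) D(3) by blast
    then show ?thesis using two[of u y r] uV xy(2) r(3) by blast
  qed
  obtain g p where g: "bij_betw g {..<card V} V" and g0: "g 0 = r"
    and p: "\<And>x. x < card V \<Longrightarrow> 0 < x \<Longrightarrow> p x < x"
    and adj: "\<And>x y. x < card V \<Longrightarrow> y < card V \<Longrightarrow>
      ?E (g x) (g y) \<longleftrightarrow> 0 < y \<and> p y = x \<or> 0 < x \<and> p x = y"
    using tree_numbering[of V r ?E, OF D(1) r(1) D(3,4) cut acyc] by metis
  have "u \<in> g ` {..<card V}" using uV bij_betw_imp_surj_on[OF g] by simp
  then obtain x0 where x0: "x0 < card V" "g x0 = u" by auto
  have pos: "0 < x0" "0 < card V"
  proof -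
    show "0 < x0" using x0(2) g0 r(2) by (cases x0) auto
    show "0 < card V" using m by linarith
  qed
  have "?E (g x0) (g 0)" using r(3) unfolding x0(2) g0 .
  then have px0: "p x0 = 0" using adj[OF x0(1) pos(2)] by simp
  show ?thesis
  proof (rule that[OF g p adj _ pos(1) x0(1) px0])
    show "g 0 \<notin> L" "g x0 \<in> L" using rL uL unfolding g0 x0(2) by simp_all
  qed
qed

section \<open>Oriented trees as subdigraphs of tournaments\<close>

lemma contains_subdigraphI:
  assumes D: "parcs D \<subseteq> pverts D \<times> pverts D" and T: "parcs T \<subseteq> pverts T \<times> pverts T"
    and inj: "inj_on F (pverts D)" and sub: "F ` pverts D \<subseteq> pverts T"
    and arcs: "\<And>a b. (a, b) \<in> parcs D \<Longrightarrow> (F a, F b) \<in> parcs T"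
  shows "contains_subdigraph T D"
proof -
  define H where "H = \<lparr>pverts = F ` pverts D, parcs = map_prod F F ` parcs D\<rparr>"
  define h where "h = \<lparr>iso_verts = F, iso_arcs = map_prod F F, iso_head = snd, iso_tail = fst\<rparr>"
  have wf: "wf_digraph (with_proj K)" if "parcs K \<subseteq> pverts K \<times> pverts K" for K :: "'c pair_pre_digraph"
    using that by (auto simp: wf_digraph_def)
  have H: "parcs H \<subseteq> pverts H \<times> pverts H" using D unfolding H_def by auto
  have "inj_on (map_prod F F) (parcs D)"
    using map_prod_inj_on[OF inj inj] D by (rule inj_on_subset)
  then have "pre_digraph.digraph_isomorphism (with_proj D) h"
    using inj wf[OF D] by (simp add: pre_digraph.digraph_isomorphism_def h_def)
  moreover have "with_proj H = app_iso h (with_proj D)"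
    by (simp add: with_proj_def app_iso_def H_def h_def)
  ultimately have "digraph_iso (with_proj D) (with_proj H)" unfolding digraph_iso_def by blast
  moreover have "subgraph (with_proj H) (with_proj T)"
    using sub arcs wf[OF H] wf[OF T] unfolding subgraph_def compatible_def by (auto simp: H_def)
  ultimately show ?thesis unfolding contains_subdigraph_def by blast
qed

lemma tournamentD:
  assumes "tournament T"
  shows "finite (pverts T)" "tournament_on (\<lambda>x y. (x, y) \<in> parcs T) (pverts T)"
    "parcs T \<subseteq> pverts T \<times> pverts T"
proof -
  obtain n G where G: "complete_digraph n (with_proj G)" and o: "orientation T G"
    using assms unfolding tournament_def by blast
  have V: "pverts T = pverts G" and un: "parcs T \<union> (parcs T)\<inverse> = parcs G"
    and disj: "parcs T \<inter> (parcs T)\<inverse> = {}" using o unfolding orientation_def by auto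
  have fin: "finite (pverts G)" and arcs: "parcs G = {(u, v). (u, v) \<in> pverts G \<times> pverts G \<and> u \<noteq> v}"
    using G unfolding complete_digraph_pair_def by auto
  show "finite (pverts T)" using fin V by simp
  show "tournament_on (\<lambda>x y. (x, y) \<in> parcs T) (pverts T)"
    unfolding tournament_on_def
  proof (intro ballI impI)
    fix x y assume "x \<in> pverts T" "y \<in> pverts T" "x \<noteq> y"
    then have "(x, y) \<in> parcs T \<union> (parcs T)\<inverse>" unfolding un arcs V by blast
    then show "(x, y) \<in> parcs T \<longleftrightarrow> (y, x) \<notin> parcs T" using disj by blast
  qed
  have "parcs T \<subseteq> parcs G" using un by blast
  then show "parcs T \<subseteq> pverts T \<times> pverts T" unfolding arcs V by blast
qed

lemma oriented_tree_in_large_tournament: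
  fixes D :: "'a pair_pre_digraph" and T :: "'b pair_pre_digraph"
  assumes "oriented_tree D" and n: "card (pverts D) = n" "n \<ge> 3" and k: "card (leaves D) = k"
    and T: "tournament T" and big: "9 * n \<le> 2 * card (pverts T) + 5 * k + 9"
  shows "contains_subdigraph T D"
proof -
  obtain G where G: "undirected_tree G" and o: "orientation D G"
    using assms(1) unfolding oriented_tree_def by blast
  have VG: "pverts D = pverts G" and un: "parcs D \<union> (parcs D)\<inverse> = parcs G"
    and disj: "parcs D \<inter> (parcs D)\<inverse> = {}" using o unfolding orientation_def by auto
  have arcG: "(u, v) \<in> parcs G \<longleftrightarrow> (u, v) \<in> parcs D \<or> (v, u) \<in> parcs D" for u v
    using un by blast
  note GD = undirected_treeD[OF G]
  define V where "V = pverts G"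
  define L where "L = {v \<in> V. card {u \<in> V. (u, v) \<in> parcs G} \<le> 1}"
  have leaves: "leaves D = L" unfolding leaves_def L_def V_def VG arcG ..
  note GV = GD[folded V_def]
  have nV: "card V = n" using n(1) unfolding V_def VG .
  obtain g p x0 where g: "bij_betw g {..<n} V"
    and p: "\<And>x. x < n \<Longrightarrow> 0 < x \<Longrightarrow> p x < x"
    and adj: "\<And>x y. x < n \<Longrightarrow> y < n \<Longrightarrow>
      (g x, g y) \<in> parcs G \<longleftrightarrow> 0 < y \<and> p y = x \<or> 0 < x \<and> p x = y"
    and g0: "g 0 \<notin> L" and x0: "0 < x0" "x0 < n" "p x0 = 0" "g x0 \<in> L"
    using tree_numbering_from_leaf_neighbour[OF G, folded V_def, folded L_def, unfolded nV] n(2) by blast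
  have ginj: "inj_on g {..<n}" and gV: "g ` {..<n} = V" using g unfolding bij_betw_def by auto
  have gin: "g x \<in> V" if "x < n" for x using gV that by blast
  define A where "A = {x. x < n \<and> g x \<notin> L}"
  define Lf where "Lf = {x. x < n \<and> g x \<in> L}"
  define up where "up = {x. (g x, g (p x)) \<in> parcs D}"
  have parA: "p x \<in> A" if x: "x < n" "0 < x" for x
  proof -
    have lt: "p x < x" using p x by blast
    have "g (p x) \<notin> L"
    proof (cases "p x = 0")
      case True
      then show ?thesis using g0 by simp
    next
      case False
      let ?y = "p x"
      have y: "?y < n" "0 < ?y" "p ?y < ?y" using False lt x p[of "p x"] by auto
      then have less: "p ?y < n" "p ?y \<noteq> x" using lt by auto
      have "{g (p ?y), g x} \<subseteq> {u \<in> V. (u, g ?y) \<in> parcs G}"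
        using adj[OF less(1) y(1)] adj[OF x(1) y(1)] y x gin[OF less(1)] gin[OF x(1)]
        by simp
      \<comment> \<open>A parent other than the root has two neighbours, its own parent and its
        child.\<close>
      then have "card {g (p ?y), g x} \<le> card {u \<in> V. (u, g ?y) \<in> parcs G}"
        using GV(1) by (intro card_mono) auto
      moreover have "g (p ?y) \<noteq> g x" using ginj less x(1) unfolding inj_on_def by auto
      ultimately show ?thesis unfolding L_def by simp
    qed
    then show ?thesis using lt x(1) unfolding A_def by simp
  qed
  have "0 < n" using n(2) by simp
  then have t: "rooted_tree A 0 p"
    using g0 p parA unfolding rooted_tree_def by (auto simp: A_def)
  have pend: "insert 0 (childless A 0 p) \<subseteq> p ` Lf"
  proof
    fix x assume x: "x \<in> insert 0 (childless A 0 p)"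
    show "x \<in> p ` Lf"
    proof (cases "x = 0")
      case True
      then show ?thesis using x0 unfolding Lf_def by force
    next
      case False
      then have xc: "x \<in> childless A 0 p" using x by simp
      then have xA: "x < n" "g x \<notin> L" unfolding childless_def A_def by auto
      \<comment> \<open>An inner vertex has a neighbour besides its parent. This is a child, and as
        no child of \<open>x\<close> is in \<open>A\<close>, it is a leaf.\<close>
      have "\<not> {u \<in> V. (u, g x) \<in> parcs G} \<subseteq> {g (p x)}"
      proof
        assume "{u \<in> V. (u, g x) \<in> parcs G} \<subseteq> {g (p x)}"
        then have "card {u \<in> V. (u, g x) \<in> parcs G} \<le> card {g (p x)}"
          by (intro card_mono) auto
        then show False using xA gin[OF xA(1)] unfolding L_def by simp
      qed
      then obtain u where u: "u \<in> V" "(u, g x) \<in> parcs G" "u \<noteq> g (p x)" by blast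
      have "u \<in> g ` {..<n}" using u(1) gV by simp
      then obtain y where y: "y < n" "u = g y" by auto
      then have py: "0 < y" "p y = x" using adj[of y x] xA(1) u by auto
      have "y \<notin> A" using xc py unfolding childless_def by auto
      then show ?thesis using y(1) py(2) unfolding A_def Lf_def by blast
    qed
  qed
  have fin: "finite (Lf \<inter> up)" "finite (Lf - up)" "finite A" "finite Lf" unfolding Lf_def A_def by auto
  have cLf: "card Lf = k"
  proof -
    have "g ` Lf = L"
      using gV unfolding Lf_def L_def by auto
    moreover have "inj_on g Lf" using ginj by (rule inj_on_subset) (auto simp: Lf_def)
    ultimately show ?thesis using k leaves card_image by metis
  qed
  have cUp: "card (Lf \<inter> up) + card (Lf - up) = k"
    using cLf fin(4) by (metis card_Diff_subset_Int card_mono finite_Int inf_le1 le_add_diff_inverse)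
  have cA: "card A + k = n"
  proof -
    have "card (A \<union> Lf) = card A + card Lf" using fin by (intro card_Un_disjoint) (auto simp: A_def Lf_def)
    moreover have "A \<union> Lf = {..<n}" by (auto simp: A_def Lf_def)
    ultimately show ?thesis using cLf by simp
  qed
  have single: "A = {0}" if "card A = 1"
  proof -
    have "0 \<in> A" using t unfolding rooted_tree_def by blast
    then show ?thesis using that by (metis card_1_singletonE singletonD)
  qed
  have LfU: "(Lf \<inter> up) \<union> (Lf - up) = Lf" by blast
  have "0 \<notin> Lf" using g0 unfolding Lf_def by simp
  then have "p ` Lf \<subseteq> A" using parA unfolding Lf_def by (force intro: gr0I)
  then have q: "p ` ((Lf \<inter> up) \<union> (Lf - up)) \<subseteq> A" unfolding LfU .
  have pend': "insert 0 (childless A 0 p) \<subseteq> p ` ((Lf \<inter> up) \<union> (Lf - up))" unfolding LfU by (rule pend)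
  have "0 < card A" using t fin(3) card_gt_0_iff unfolding rooted_tree_def by blast
  then have b1: "2 * card (Lf \<inter> up) + 2 * card (Lf - up) \<le> card (pverts T)" using big cUp cA by linarith
  \<comment> \<open>With \<open>card A = d + 1\<close>, \<open>big\<close> says that twice the order
    is at least \<open>9d + 4k\<close>. For \<open>d \<ge> 1\<close> this is at least
    \<open>8d + 4k + 1\<close>, so the order is at least \<open>4d + 2k + 1\<close> by
    parity.\<close>
  have b2: "A = {0} \<or> 4 * card A + 2 * card (Lf \<inter> up) + 2 * card (Lf - up) \<le> card (pverts T) + 3"
  proof (cases "card A = 1")
    case False
    then have "2 \<le> card A" using \<open>0 < card A\<close> by linarith
    then show ?thesis using big cA cUp by linarith
  qed (use single in blast)
  have dj: "Lf \<inter> up \<inter> (Lf - up) = {}" "A \<inter> ((Lf \<inter> up) \<union> (Lf - up)) = {}"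
    unfolding A_def Lf_def by auto
  note TD = tournamentD[OF T]
  obtain f where emb: "oriented_embedding A 0 p up (\<lambda>x y. (x, y) \<in> parcs T) (pverts T) f"
    and inj: "inj_on f (A \<union> (Lf \<inter> up) \<union> (Lf - up))" and img: "f ` (A \<union> (Lf \<inter> up) \<union> (Lf - up)) \<subseteq> pverts T"
    and Li: "\<forall>x\<in>Lf \<inter> up. (f x, f (p x)) \<in> parcs T"
    and Lo: "\<forall>x\<in>Lf - up. (f (p x), f x) \<in> parcs T"
    by (rule tree_with_leaves_in_tournament[OF t fin(1,2) dj q pend' TD(1,2) b1 b2, of up])
  have all: "A \<union> (Lf \<inter> up) \<union> (Lf - up) = {..<n}" by (auto simp: A_def Lf_def)
  note inj = inj[unfolded all] and img = img[unfolded all]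
  have arc: "if x \<in> up then (f x, f (p x)) \<in> parcs T else (f (p x), f x) \<in> parcs T"
    if "x < n" "0 < x" for x
  proof (cases "g x \<in> L")
    case True
    then show ?thesis using Li Lo that unfolding Lf_def by auto
  next
    case False
    then show ?thesis using emb that unfolding oriented_embedding_def A_def by auto
  qed
  define F where "F = f \<circ> the_inv_into {..<n} g"
  have Fg: "F (g x) = f x" if "x < n" for x
    using that ginj unfolding F_def by (simp add: the_inv_into_f_f)
  have DG: "(a, b) \<in> parcs G" "a \<in> V" "b \<in> V" if "(a, b) \<in> parcs D" for a b
  proof -
    show "(a, b) \<in> parcs G" using that arcG[of a b] by simp
    then show "a \<in> V" "b \<in> V" using GV(3)[THEN spec, THEN spec, THEN mp] by simp_all
  qed
  have VD: "pverts D = g ` {..<n}" unfolding VG gV V_def ..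
  show ?thesis
  proof (rule contains_subdigraphI[OF _ TD(3)])
    show "parcs D \<subseteq> pverts D \<times> pverts D" using DG unfolding VG V_def by auto
    show "inj_on F (pverts D)"
      using inj Fg unfolding VD by (auto simp: inj_on_def)
    show "F ` pverts D \<subseteq> pverts T"
      using img Fg unfolding VD by auto
    fix a b assume ab: "(a, b) \<in> parcs D"
    then have "a \<in> g ` {..<n}" "b \<in> g ` {..<n}" using DG unfolding gV by simp_all
    then obtain x y where xy: "x < n" "a = g x" "y < n" "b = g y" by auto
    have "(g x, g y) \<in> parcs G" using DG(1)[OF ab] unfolding xy .
    moreover have "(b, a) \<notin> parcs D" using ab disj by blast
    ultimately consider "0 < y" "p y = x" "y \<notin> up" | "0 < x" "p x = y" "x \<in> up"
      using adj[OF xy(1,3)] ab unfolding up_def xy by auto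
    then show "(F a, F b) \<in> parcs T"
    proof cases
      case 1
      then show ?thesis using arc[OF xy(3)] Fg xy by auto
    next
      case 2
      then show ?thesis using arc[OF xy(1)] Fg xy by auto
    qed
  qed
qed

theorem mainTheorem4:
  fixes D :: "'a pair_pre_digraph" and n k :: nat
  assumes "oriented_tree D"
    and "card (pverts D) = n" and "n \<ge> 3"
    and "card (leaves D) = k"
  shows "unavoidable TYPE('b) (9 / 2 * real n - 5 / 2 * real k - 9 / 2) D"
  unfolding unavoidable_def
proof (intro allI impI, elim conjE)
  fix T :: "'b pair_pre_digraph"
  assume T: "tournament T" and c: "int (card (pverts T)) = \<lceil>9 / 2 * real n - 5 / 2 * real k - 9 / 2\<rceil>"
  let ?c = "card (pverts T)"
  have "9 / 2 * real n - 5 / 2 * real k - 9 / 2 \<le> real_of_int (int ?c)" unfolding c by simp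
  then have "9 * real n \<le> real (2 * ?c + 5 * k + 9)" by simp
  then have "9 * n \<le> 2 * ?c + 5 * k + 9" by linarith
  then show "contains_subdigraph T D" by (rule oriented_tree_in_large_tournament[OF assms T])
qed

end
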